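(* For every $i\in\{1,\dots,N\}$ let $(X_i,d_i)$ be a Polish metric space and $\rho_i\in\mathcal{P}(X_i)$ a probability measure, and let $c:X_1\times\dots\times X_N\to\mathbb{R}$ be a bounded (Borel) cost function. Then for every $\varepsilon>0$: (i) The dual functional $D^N_{\varepsilon}$ is well defined on its domain of definition $L^{\exp}_\varepsilon(\rho_1)\times\dots\times L^{\exp}_\varepsilon(\rho_N)$, and moreover, for all $u_i\in L^{\exp}_{\varepsilon}(\rho_i)$, $i=1,\dots,N$, $$D^N_{\varepsilon}\bigl(\hat u_1^{(N,c,\varepsilon)},u_2,\dots,u_N\bigr)\ge D^N_{\varepsilon}(u_1,u_2,\dots,u_N),$$ $$D^N_{\varepsilon}\bigl(\hat u_1^{(N,c,\varepsilon)},u_2,\dots,u_N\bigr)= D^N_{\varepsilon}(u_1,u_2,\dots,u_N)\quad\text{if and only if}\quad u_1=\hat u_1^{(N,c,\varepsilon)}.$$ (ii) The supremum of $D^N_\varepsilon$ over $L^{\exp}_\varepsilon(\rho_1)\times\dots\times L^{\exp}_\varepsilon(\rho_N)$ is attained, up to the trivial transformations $(u_1,\dots,u_N)\mapsto(u_1+t_1,\dots,u_N+t_N)$ with $t_i\in\mathbb{R}$, $\sum_i t_i=0$, for a unique $N$-tuple $(u_1^0,\dots,u_N^0)$, and in particular $u_i^0\in L^\infty(\rho_i)$ for all $i\in\{1,\dots,N\}$. Moreover, if $\gamma^{0,N}=e^{(\sum_i u_i^0(x_i)-c)/\varepsilon}\rho^N$, then $\gamma^{0,N}$ is the minimizer of the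 multi-marginal Schrödinger problem defining $\mathrm{OT}^N_\varepsilon(\rho_1,\dots,\rho_N)$. (iii) Duality holds: $$\mathrm{OT}^N_{\varepsilon}(\rho_1,\dots,\rho_N)=\sup\left\{D^N_{\varepsilon}(u_1,\dots,u_N)\;:\;u_i\in L^{\exp}_{\varepsilon}(\rho_i),\ i\in\{1,\dots,N\}\right\}+\varepsilon.$$
   Context: $L^{\exp}_{\varepsilon}(\rho)$ is the set of measurable functions $u$ with values in $[-\infty,\infty)$ and $0<\int e^{u/\varepsilon}\,d\rho<\infty$. $\rho^N=\rho_1\otimes\dots\otimes\rho_N$. The dual functional $D^N_\varepsilon:L^{\exp}_\varepsilon(\rho_1)\times\dots\times L^{\exp}_\varepsilon(\rho_N)\to[-\infty,+\infty)$ is $$D^N_{\varepsilon}(u_1,\dots,u_N)=\sum_{i=1}^N\int_{X_i}u_i\,d\rho_i-\varepsilon\int_{X_1\times\dots\times X_N}e^{\frac{\sum_{i=1}^N u_i(x_i)-c(x_1,\dots,x_N)}{\varepsilon}}\,d\rho^N.$$ The entropic $c$-transform in the first variable is $$\hat u_1^{(N,c,\varepsilon)}(x_1)=-\varepsilon\log\left(\int_{\prod_{j\neq1}X_j}e^{\frac{\sum_{j\ne1}u_j(x_j)-c(x_1,\dots,x_N)}{\varepsilon}}\,d(\otimes_{j\neq1}\rho_j)\right).$$ $k^N=e^{-c/\varepsilon}$, $\mathcal{K}=k^N\rho^N$; $\Pi(\rho_1,\dots,\rho_N)$ is the set of probability measures on $X_1\times\dots\times X_N$ with $i$-th marginal $\rho_i$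 for every $i$; $\mathrm{KL}^N(\gamma|\mathcal{K})=\int\gamma\log(\gamma/k^N)\,d\rho^N$ if $\gamma\ll\rho^N$ ($\gamma$ also denoting the density with respect to $\rho^N$), and $+\infty$ otherwise. The multi-marginal Schrödinger problem is $\mathrm{OT}^N_\varepsilon(\rho_1,\dots,\rho_N)=\inf_{\gamma\in\Pi(\rho_1,\dots,\rho_N)}\varepsilon\,\mathrm{KL}^N(\gamma|\mathcal{K})$.
   Formalization: In (i), "equality only if u_1 = û_1" is claimed (ρ_1-a.e.) only when D(û_1,u_2,…,u_N) ≠ −∞; otherwise it fails: for N = 2 and u_2 = −∞ on a set of positive, not full, measure, both sides are −∞ for every u_1. *)

theory Defs
  imports "HOL-Analysis.Analysis" "HOL-Probability.Probability"
begin

text \<open>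
  The spaces are metric spaces \<open>X 1, \<dots>, X N\<close> whose carriers lie in a common type \<open>'a\<close>, and
  points of the product are extensional functions \<open>x :: nat \<Rightarrow> 'a\<close> with \<open>x i\<close> in \<open>X i\<close>
  for \<open>i \<in> {1..N}\<close>.  As \<open>'a\<close> is arbitrary, any finite family of metric spaces is covered
  (use a disjoint sum).
\<close>

definition polish_metric :: "'a metric \<Rightarrow> bool" where
  "polish_metric X \<longleftrightarrow> mcomplete_of X \<and> separable_space (mtopology_of X)"

definition borel_of :: "'a topology \<Rightarrow> 'a measure" where
  "borel_of T = sigma (topspace T) {U. openin T U}"

definition borel_prob :: "'a metric \<Rightarrow> 'a measure \<Rightarrow> bool" where
  "borel_prob X \<rho> \<longleftrightarrow> prob_space \<rho> \<and> sets \<rho> = sets (borel_of (mtopology_of X))"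

text \<open>Exponential and logarithm with the conventions \<open>exp (-\<infinity>) = 0\<close>, \<open>exp \<infinity> = \<infinity>\<close>,
  \<open>log 0 = -\<infinity>\<close>, \<open>log \<infinity> = \<infinity>\<close>.\<close>

definition exp_ext :: "ereal \<Rightarrow> ennreal" where
  "exp_ext a = (if a = -\<infinity> then 0 else if a = \<infinity> then \<infinity> else ennreal (exp (real_of_ereal a)))"

definition log_ext :: "ennreal \<Rightarrow> ereal" where
  "log_ext a = (if a = 0 then -\<infinity> else if a = \<infinity> then \<infinity> else ereal (ln (enn2real a)))"

text \<open>Integral of an extended real valued function as the integral of its positive part minus
  that of its negative part; meaningful as soon as one of the two is finite.  Note that
  \<^const>\<open>e2ennreal\<close> sends negative arguments to 0.\<close>

definition ext_integral :: "'a measure \<Rightarrow> ('a \<Rightarrow> ereal) \<Rightarrow> ereal" where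
  "ext_integral M f =
     enn2ereal (\<integral>\<^sup>+x. e2ennreal (f x) \<partial>M) - enn2ereal (\<integral>\<^sup>+x. e2ennreal (- f x) \<partial>M)"

definition Lexp :: "real \<Rightarrow> 'a measure \<Rightarrow> ('a \<Rightarrow> ereal) set" where
  "Lexp \<epsilon> \<rho> = {u \<in> borel_measurable \<rho>. (\<forall>x\<in>space \<rho>. u x < \<infinity>) \<and>
     0 < (\<integral>\<^sup>+x. exp_ext (u x / ereal \<epsilon>) \<partial>\<rho>) \<and> (\<integral>\<^sup>+x. exp_ext (u x / ereal \<epsilon>) \<partial>\<rho>) < \<infinity>}"

definition Linfty :: "'a measure \<Rightarrow> ('a \<Rightarrow> ereal) set" where
  "Linfty \<rho> = {u \<in> borel_measurable \<rho>. \<exists>B::real. AE x in \<rho>. \<bar>u x\<bar> \<le> ereal B}"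

text \<open>The domain of the dual functional.  Only the components \<open>u i\<close> with \<open>i \<in> {1..N}\<close> matter.\<close>

definition dual_dom :: "nat \<Rightarrow> real \<Rightarrow> (nat \<Rightarrow> 'a measure) \<Rightarrow> (nat \<Rightarrow> 'a \<Rightarrow> ereal) set" where
  "dual_dom N \<epsilon> \<rho> = {u. \<forall>i\<in>{1..N}. u i \<in> Lexp \<epsilon> (\<rho> i)}"

definition gibbs :: "nat \<Rightarrow> real \<Rightarrow> ((nat \<Rightarrow> 'a) \<Rightarrow> real) \<Rightarrow> (nat \<Rightarrow> 'a \<Rightarrow> ereal) \<Rightarrow>
    (nat \<Rightarrow> 'a) \<Rightarrow> ennreal" where
  "gibbs N \<epsilon> c u x = exp_ext (((\<Sum>i\<in>{1..N}. u i (x i)) - ereal (c x)) / ereal \<epsilon>)"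

definition dual :: "nat \<Rightarrow> real \<Rightarrow> ((nat \<Rightarrow> 'a) \<Rightarrow> real) \<Rightarrow> (nat \<Rightarrow> 'a measure) \<Rightarrow>
    (nat \<Rightarrow> 'a \<Rightarrow> ereal) \<Rightarrow> ereal" where
  "dual N \<epsilon> c \<rho> u = (\<Sum>i\<in>{1..N}. ext_integral (\<rho> i) (u i))
     - ereal \<epsilon> * enn2ereal (\<integral>\<^sup>+x. gibbs N \<epsilon> c u x \<partial>(Pi\<^sub>M {1..N} \<rho>))"

definition c_transform1 :: "nat \<Rightarrow> real \<Rightarrow> ((nat \<Rightarrow> 'a) \<Rightarrow> real) \<Rightarrow> (nat \<Rightarrow> 'a measure) \<Rightarrow>
    (nat \<Rightarrow> 'a \<Rightarrow> ereal) \<Rightarrow> 'a \<Rightarrow> ereal" where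
  "c_transform1 N \<epsilon> c \<rho> u x1 = - (ereal \<epsilon> * log_ext (\<integral>\<^sup>+y.
     exp_ext (((\<Sum>j\<in>{2..N}. u j (y j)) - ereal (c (y(1 := x1)))) / ereal \<epsilon>) \<partial>(Pi\<^sub>M {2..N} \<rho>)))"

definition couplings :: "nat \<Rightarrow> (nat \<Rightarrow> 'a measure) \<Rightarrow> (nat \<Rightarrow> 'a) measure set" where
  "couplings N \<rho> = {\<gamma>. prob_space \<gamma> \<and> sets \<gamma> = sets (Pi\<^sub>M {1..N} \<rho>) \<and>
     (\<forall>i\<in>{1..N}. distr \<gamma> (\<rho> i) (\<lambda>x. x i) = \<rho> i)}"

text \<open>\<open>KL M k \<gamma>\<close> is the divergence of \<open>\<gamma>\<close> from the measure \<open>k M\<close>, for a strictly positive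
  real density \<open>k\<close>; since \<open>0 * r = 0\<close>, the convention \<open>0 log 0 = 0\<close> is built in.\<close>

definition KL :: "'a measure \<Rightarrow> ('a \<Rightarrow> real) \<Rightarrow> 'a measure \<Rightarrow> ereal" where
  "KL M k \<gamma> = (if absolutely_continuous M \<gamma>
     then ext_integral M (\<lambda>x. let g = enn2real (RN_deriv M \<gamma> x) in ereal (g * ln (g / k x)))
     else \<infinity>)"

definition schroedinger_cost :: "nat \<Rightarrow> real \<Rightarrow> ((nat \<Rightarrow> 'a) \<Rightarrow> real) \<Rightarrow> (nat \<Rightarrow> 'a measure) \<Rightarrow>
    (nat \<Rightarrow> 'a) measure \<Rightarrow> ereal" where
  "schroedinger_cost N \<epsilon> c \<rho> \<gamma> = ereal \<epsilon> * KL (Pi\<^sub>M {1..N} \<rho>) (\<lambda>x. exp (- c x / \<epsilon>)) \<gamma>"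

definition OT :: "nat \<Rightarrow> real \<Rightarrow> ((nat \<Rightarrow> 'a) \<Rightarrow> real) \<Rightarrow> (nat \<Rightarrow> 'a measure) \<Rightarrow> ereal" where
  "OT N \<epsilon> c \<rho> = (INF \<gamma>\<in>couplings N \<rho>. schroedinger_cost N \<epsilon> c \<rho> \<gamma>)"

end

theory Submission
  imports Defs
begin

text \<open>
  Replacing one potential by its entropic transform normalises the mass of the Gibbs density and
  changes the dual value by \<open>\<epsilon> \<integral> (exp t - 1 - t)\<close> with \<open>t = (u\<^sub>i - v\<^sub>i) / \<epsilon>\<close>, where \<open>v\<^sub>i\<close>
  is the transform, whence the statements on the transform.  Transforming all coordinates in turn bounds \<open>\<Sum>\<^sub>i u\<^sub>i(x\<^sub>i)\<close> uniformly in terms of the cost,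
  and on such tuples the dual functional is strongly concave in this sum: a maximizing sequence
  among bounded tuples therefore converges in mean square, at a rate that can be prescribed, hence
  almost everywhere, and the single potentials converge up to constants along sections of the
  product.  No weak compactness is needed.

  Varying a maximizer in the direction of an indicator function of one variable shows that its Gibbs
  measure has the right marginals.  Finally, for a coupling with density \<open>g\<close> and a Gibbs density
  \<open>h\<close>, the duality gap is \<open>\<epsilon> \<integral> (g log (g / h) - g + h) \<ge> 0\<close>, which vanishes only for \<open>g = h\<close>; this
  gives duality and both uniqueness claims at once.
\<close>

section \<open>Extended real integrals and Borel sets\<close>

text \<open>The maximization runs over bounded real tuples only, where no value is
  \<open>-\<infinity>\<close> and the dual functional depends on the sum of the potentials alone.
  The optimizer never has to be compared directly with unbounded or infinite competitors: its Gibbs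
  measure is a coupling whose cost equals its dual value plus \<open>e\<close>, and weak duality
  against this one coupling bounds the dual value of every element of the domain. The additive
  \<open>e\<close> stems from the unit mass of a coupling. Boundedness of the cost is the source of
  the estimates: it pins the transform of a potential to within \<open>B\<close> of a constant, and
  this radius does not depend on the potential. The constants can be arbitrarily large, since shifts
  with zero sum leave the functional unchanged; for this reason the estimates concern sums of
  potentials. On the measure-theoretic side, the cost is Borel for the product topology, whereas
  Tonelli's theorem works with the product of the Borel sigma-algebras; separability closes this
  gap.\<close>

lemma second_countable_mtopology_of:
  assumes "separable_space (mtopology_of X)"
  shows "second_countable (mtopology_of X)"
proof -
  interpret Metric_space "mspace X" "mdist X" by simp
  have T: "mtopology_of X = mtopology" by (simp add: mtopology_of_def)
  obtain C where C: "countable C" "C \<subseteq> mspace X" "mtopology closure_of C = mspace X"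
    using assms unfolding T separable_space_def by auto
  let ?B = "(\<lambda>(x, n). mball x (1 / Suc n)) ` (C \<times> (UNIV :: nat set))"
  have "\<exists>V\<in>?B. x \<in> V \<and> V \<subseteq> U" if U: "openin mtopology U" "x \<in> U" for U x
  proof -
    obtain r where r: "r > 0" "mball x r \<subseteq> U" and x: "x \<in> mspace X"
      using U unfolding openin_mtopology by blast
    \<comment> \<open>Half of \<open>r\<close>, because \<open>x\<close> is within one such radius
      of the centre \<open>y\<close>, and a point of the ball around \<open>y\<close> adds a
      second.\<close>
    obtain n where n: "1 / real (Suc n) < r / 2"
      using reals_Archimedean[of "r / 2"] r(1) by (auto simp: inverse_eq_divide)
    have "x \<in> mtopology closure_of C" using C x by simp
    then obtain y where y: "y \<in> C" "y \<in> mball x (1 / Suc n)"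
      unfolding metric_closure_of using zero_less_divide_1_iff[of "real (Suc n)"]
      by (smt (verit, ccfv_threshold) mem_Collect_eq of_nat_0_less_iff zero_less_Suc)
    have "mball y (1 / Suc n) \<subseteq> mball x r"
    proof
      fix z assume z: "z \<in> mball y (1 / Suc n)"
      have "mdist X x z \<le> mdist X x y + mdist X y z"
        using z y by (intro triangle) auto
      also have "\<dots> < r" using y z n by auto
      finally show "z \<in> mball x r" using z x by simp
    qed
    moreover have "x \<in> mball y (1 / Suc n)" using y x by (simp add: commute)
    ultimately show ?thesis using y r by blast
  qed
  moreover have "countable ?B" using C by simp
  ultimately show ?thesis
    unfolding second_countable_def T by (intro exI[of _ ?B]) auto
qed

lemma sets_borel_of: "sets (borel_of T) = sigma_sets (topspace T) {U. openin T U}"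
  unfolding borel_of_def by (intro sets_measure_of) (auto dest: openin_subset)

lemma space_borel_of: "space (borel_of T) = topspace T"
  unfolding borel_of_def by (intro space_measure_of) (auto dest: openin_subset)

lemma openin_imp_sets_borel_of: "openin T U \<Longrightarrow> U \<in> sets (borel_of T)"
  unfolding sets_borel_of by auto

text \<open>In a finite product of second countable spaces each open set is a countable union of
  boxes over basic open sets, and boxes are measurable. This makes a Borel cost on the topological
  product measurable for \<open>PiM\<close>.\<close>

lemma sets_borel_of_product_subset:
  assumes I: "finite I" and sc: "\<And>i. i \<in> I \<Longrightarrow> second_countable (T i)"
  shows "sets (borel_of (product_topology T I)) \<subseteq> sets (PiM I (\<lambda>i. borel_of (T i)))"
proof -
  obtain \<B> where \<B>: "\<And>i. i \<in> I \<Longrightarrow> countable (\<B> i)"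
    "\<And>i V. i \<in> I \<Longrightarrow> V \<in> \<B> i \<Longrightarrow> openin (T i) V"
    "\<And>i U x. i \<in> I \<Longrightarrow> openin (T i) U \<Longrightarrow> x \<in> U \<Longrightarrow> \<exists>V\<in>\<B> i. x \<in> V \<and> V \<subseteq> U"
    using sc unfolding second_countable_def by metis
  have "W \<in> sets (PiM I (\<lambda>i. borel_of (T i)))" if W: "openin (product_topology T I) W" for W
  proof -
    \<comment> \<open>Boxes are indexed by a choice of one basic set per coordinate; finitely many
      coordinates and countable bases leave countably many choices.\<close>
    let ?F = "{F \<in> PiE I \<B>. PiE I F \<subseteq> W}"
    have "W = (\<Union>F\<in>?F. PiE I F)"
    proof (intro subset_antisym subsetI)
      fix x assume "x \<in> W"
      then obtain U where U: "\<And>i. i \<in> I \<Longrightarrow> openin (T i) (U i)" "x \<in> PiE I U" "PiE I U \<subseteq> W"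
        using W unfolding openin_product_topology_alt by metis
      have "\<forall>i\<in>I. \<exists>V\<in>\<B> i. x i \<in> V \<and> V \<subseteq> U i"
        using \<B>(3) U by (auto simp: PiE_iff)
      then obtain V where V: "\<And>i. i \<in> I \<Longrightarrow> V i \<in> \<B> i \<and> x i \<in> V i \<and> V i \<subseteq> U i"
        by metis
      let ?V = "restrict V I"
      have "?V \<in> PiE I \<B>" using V by auto
      moreover have "PiE I ?V \<subseteq> PiE I U" using V by (intro PiE_mono) auto
      moreover have "x \<in> PiE I ?V" using V U(2) by (auto simp: PiE_iff)
      ultimately show "x \<in> (\<Union>F\<in>?F. PiE I F)"
        using U(3) by (intro UN_I[of ?V]) auto
    next
      fix x assume "x \<in> (\<Union>F\<in>?F. PiE I F)"
      then show "x \<in> W" by blast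
    qed
    moreover have "countable ?F"
    proof (rule countable_subset)
      show "countable (PiE I \<B>)" using I \<B>(1) by (rule countable_PiE)
    qed auto
    moreover have "PiE I F \<in> sets (PiM I (\<lambda>i. borel_of (T i)))" if "F \<in> ?F" for F
      using that \<B>(2) I by (intro sets_PiM_I_finite) (auto intro!: openin_imp_sets_borel_of)
    ultimately show ?thesis
      by (metis (mono_tags) sets.countable_UN'')
  qed
  moreover have "space (PiM I (\<lambda>i. borel_of (T i))) = topspace (product_topology T I)"
    by (simp add: space_PiM space_borel_of)
  ultimately show ?thesis
    unfolding sets_borel_of
    using sets.sigma_sets_subset[of "{U. openin (product_topology T I) U}" "PiM I (\<lambda>i. borel_of (T i))"]
    by auto
qed

section \<open>Extended exponentials and functions with integrable positive part\<close>

lemma exp_ext_ereal [simp]: "exp_ext (ereal r) = ennreal (exp r)"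
  by (simp add: exp_ext_def)

lemma exp_ext_MInf [simp]: "exp_ext (-\<infinity>) = 0"
  by (simp add: exp_ext_def)

lemma measurable_exp_ext [measurable]: "exp_ext \<in> borel_measurable borel"
  unfolding exp_ext_def[abs_def] by measurable

lemma exp_ext_add:
  assumes "a \<noteq> \<infinity>" "b \<noteq> \<infinity>"
  shows "exp_ext (a + b) = exp_ext a * exp_ext b"
  using assms by (cases a; cases b) (auto simp: exp_add ennreal_mult)

lemma ereal_div_real_neq_top: "e > 0 \<Longrightarrow> a \<noteq> \<infinity> \<Longrightarrow> a / ereal e \<noteq> \<infinity>"
  by (cases a) auto

text \<open>The exponential turns sums into products as long as no summand is
  \<open>\<infinity>\<close>: in \<open>ereal\<close> the sum of \<open>-\<infinity>\<close> and
  \<open>\<infinity>\<close> is \<open>\<infinity>\<close>, whereas \<open>0 * \<infinity>\<close>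
  in \<open>ennreal\<close> is \<open>0\<close>.\<close>

lemma exp_ext_div_eq_prod:
  assumes e: "e > 0" and J: "finite J" "\<And>j. j \<in> J \<Longrightarrow> a j \<noteq> \<infinity>"
  shows "exp_ext (((\<Sum>j\<in>J. a j) - ereal r) / ereal e)
    = (\<Prod>j\<in>J. exp_ext (a j / ereal e)) * ennreal (exp (- r / e))"
proof -
  \<comment> \<open>That the partial sum stays below \<open>\<infinity>\<close> travels along in the
    induction, since the addition rule asks for it.\<close>
  have "(\<Sum>j\<in>J. a j) \<noteq> \<infinity> \<and> exp_ext ((\<Sum>j\<in>J. a j) / ereal e) = (\<Prod>j\<in>J. exp_ext (a j / ereal e))"
    using J
  proof (induction J)
    case (insert j J)
    have "(a j + (\<Sum>j\<in>J. a j)) / ereal e = a j / ereal e + (\<Sum>j\<in>J. a j) / ereal e"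
      using insert e by (cases "a j"; cases "\<Sum>j\<in>J. a j") (auto simp: add_divide_distrib)
    then show ?case
      using insert e exp_ext_add[of "a j / ereal e" "(\<Sum>j\<in>J. a j) / ereal e"]
      by (auto simp: ereal_div_real_neq_top)
  qed (use e in \<open>simp add: zero_ereal_def one_ennreal_def\<close>)
  moreover from this e have "exp_ext (((\<Sum>j\<in>J. a j) - ereal r) / ereal e)
      = exp_ext ((\<Sum>j\<in>J. a j) / ereal e) * exp_ext (ereal (- r / e))"
  proof (cases "\<Sum>j\<in>J. a j")
    case (real s)
    then show ?thesis using e by (simp add: diff_divide_distrib exp_add[symmetric] ennreal_mult[symmetric])
  qed auto
  ultimately show ?thesis by simp
qed

text \<open>From \<open>s \<le> exp s\<close> at \<open>s = u / e\<close>. It makes the positive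
  part of every function in \<open>Lexp\<close> integrable, so that the difference in
  \<open>ext_integral\<close> is never one of two infinities.\<close>

lemma e2ennreal_le_exp_ext:
  assumes e: "e > 0" and u: "u \<noteq> \<infinity>"
  shows "e2ennreal u \<le> ennreal e * exp_ext (u / ereal e)"
proof (cases u)
  case (real r)
  have "r / e \<le> exp (r / e)" using exp_ge_add_one_self[of "r / e"] by linarith
  then have "r \<le> e * exp (r / e)" using e by (simp add: field_simps)
  then show ?thesis using real e by (simp add: ennreal_mult[symmetric] ennreal_leI)
qed (use u in \<open>auto simp: e2ennreal_neg\<close>)

lemma nn_integral_pos_part_Lexp:
  assumes "e > 0" "u \<in> Lexp e M"
  shows "(\<integral>\<^sup>+x. e2ennreal (u x) \<partial>M) < \<infinity>"
proof -
  have [measurable]: "u \<in> borel_measurable M" using assms by (simp add: Lexp_def)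
  have "(\<integral>\<^sup>+x. e2ennreal (u x) \<partial>M) \<le> (\<integral>\<^sup>+x. ennreal e * exp_ext (u x / ereal e) \<partial>M)"
    using assms by (intro nn_integral_mono e2ennreal_le_exp_ext) (auto simp: Lexp_def)
  also have "\<dots> = ennreal e * (\<integral>\<^sup>+x. exp_ext (u x / ereal e) \<partial>M)"
    by (intro nn_integral_cmult) measurable
  also have "\<dots> < \<infinity>" using assms by (auto simp: Lexp_def ennreal_mult_less_top)
  finally show ?thesis .
qed

lemma ext_integral_cong_AE:
  assumes "AE x in M. f x = g x"
  shows "ext_integral M f = ext_integral M g"
proof -
  have "(\<integral>\<^sup>+x. e2ennreal (f x) \<partial>M) = (\<integral>\<^sup>+x. e2ennreal (g x) \<partial>M)"
    using assms by (intro nn_integral_cong_AE) auto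
  moreover have "(\<integral>\<^sup>+x. e2ennreal (- f x) \<partial>M) = (\<integral>\<^sup>+x. e2ennreal (- g x) \<partial>M)"
    using assms by (intro nn_integral_cong_AE) auto
  ultimately show ?thesis unfolding ext_integral_def by simp
qed

lemma ext_integral_real:
  assumes "integrable M f"
  shows "ext_integral M (\<lambda>x. ereal (f x)) = ereal (\<integral>x. f x \<partial>M)"
proof -
  obtain r q where rq: "0 \<le> r" "0 \<le> q" "(\<integral>\<^sup>+x. ennreal (f x) \<partial>M) = ennreal r"
    "(\<integral>\<^sup>+x. ennreal (- f x) \<partial>M) = ennreal q" "integral\<^sup>L M f = r - q"
    using integrableE[OF assms] by metis
  then show ?thesis unfolding ext_integral_def by simp
qed

lemma integrable_of_finite_parts:
  fixes u :: "'a \<Rightarrow> ereal"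
  assumes u [measurable]: "u \<in> borel_measurable M"
    and pos: "(\<integral>\<^sup>+x. e2ennreal (u x) \<partial>M) < \<infinity>" and neg: "(\<integral>\<^sup>+x. e2ennreal (- u x) \<partial>M) < \<infinity>"
  shows "AE x in M. u x = ereal (real_of_ereal (u x))"
    and "integrable M (\<lambda>x. real_of_ereal (u x))"
proof -
  have "AE x in M. e2ennreal (u x) \<noteq> \<infinity>" "AE x in M. e2ennreal (- u x) \<noteq> \<infinity>"
    using nn_integral_PInf_AE[of "\<lambda>x. e2ennreal (u x)" M]
      nn_integral_PInf_AE[of "\<lambda>x. e2ennreal (- u x)" M] pos neg by auto
  then show *: "AE x in M. u x = ereal (real_of_ereal (u x))"
  proof eventually_elim
    case (elim x)
    then show ?case by (cases "u x") auto
  qed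
  have "(\<integral>\<^sup>+x. ennreal (real_of_ereal (u x)) \<partial>M) = (\<integral>\<^sup>+x. e2ennreal (u x) \<partial>M)"
    using *
  proof (intro nn_integral_cong_AE, eventually_elim)
    case (elim x)
    then show ?case by (cases "u x") auto
  qed
  moreover have "(\<integral>\<^sup>+x. ennreal (- real_of_ereal (u x)) \<partial>M) = (\<integral>\<^sup>+x. e2ennreal (- u x) \<partial>M)"
    using *
  proof (intro nn_integral_cong_AE, eventually_elim)
    case (elim x)
    then show ?case by (cases "u x") auto
  qed
  ultimately show "integrable M (\<lambda>x. real_of_ereal (u x))"
    using pos neg by (auto simp: real_integrable_def)
qed

lemma ext_integral_Lexp_not_top:
  assumes "e > 0" "u \<in> Lexp e M"
  shows "ext_integral M u \<noteq> \<infinity>"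
  using nn_integral_pos_part_Lexp[OF assms] unfolding ext_integral_def
  by (cases "enn2ereal (\<integral>\<^sup>+x. e2ennreal (u x) \<partial>M)"; cases "enn2ereal (\<integral>\<^sup>+x. e2ennreal (- u x) \<partial>M)")
     (auto simp: top_unique)

text \<open>On \<open>Lexp\<close> the positive part is integrable, so \<open>-\<infinity>\<close>
  is the only possible infinite value; ruling it out leaves the ordinary integral of an almost
  everywhere real function.\<close>

lemma Lexp_finite_integral:
  assumes e: "e > 0" and u: "u \<in> Lexp e M" and fin: "ext_integral M u \<noteq> -\<infinity>"
  shows "AE x in M. u x = ereal (real_of_ereal (u x))"
    and "integrable M (\<lambda>x. real_of_ereal (u x))"
    and "ext_integral M u = ereal (\<integral>x. real_of_ereal (u x) \<partial>M)"
proof -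
  have [measurable]: "u \<in> borel_measurable M" using u by (simp add: Lexp_def)
  note pos = nn_integral_pos_part_Lexp[OF e u]
  have neg: "(\<integral>\<^sup>+x. e2ennreal (- u x) \<partial>M) < \<infinity>"
  proof (rule ccontr)
    assume "\<not> ?thesis"
    then have "(\<integral>\<^sup>+x. e2ennreal (- u x) \<partial>M) = \<top>" by (simp add: less_top[symmetric])
    moreover have "\<bar>enn2ereal (\<integral>\<^sup>+x. e2ennreal (u x) \<partial>M)\<bar> \<noteq> \<infinity>" using pos by auto
    ultimately have "ext_integral M u = -\<infinity>"
      unfolding ext_integral_def by (cases "enn2ereal (\<integral>\<^sup>+x. e2ennreal (u x) \<partial>M)") auto
    with fin show False by simp
  qed
  note * = integrable_of_finite_parts[OF _ pos neg]
  show "AE x in M. u x = ereal (real_of_ereal (u x))" "integrable M (\<lambda>x. real_of_ereal (u x))"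
    using * by auto
  show "ext_integral M u = ereal (\<integral>x. real_of_ereal (u x) \<partial>M)"
    using *(1) ext_integral_cong_AE[OF *(1)] ext_integral_real[OF *(2)] by auto
qed

section \<open>The entropic transform\<close>

text \<open>Every index carries a probability measure because the product-measure locale interpreted
  below demands it; the theorem fills the indices outside \<open>{1..N}\<close> with a point mass.
  \<open>B\<close> bounds the cost on the whole product.\<close>

locale entropic_ot =
  fixes N :: nat and M :: "nat \<Rightarrow> 'a measure" and c :: "(nat \<Rightarrow> 'a) \<Rightarrow> real" and e B :: real
  assumes prob_space_M: "\<And>i. prob_space (M i)"
    and N_pos: "N \<ge> 1"
    and c_measurable [measurable]: "c \<in> borel_measurable (PiM {1..N} M)"
    and c_bounded: "\<And>x. x \<in> space (PiM {1..N} M) \<Longrightarrow> \<bar>c x\<bar> \<le> B"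
    and e_pos: "e > 0"

sublocale entropic_ot \<subseteq> product_prob_space M "{1..N}"
proof -
  interpret prob_space "M i" for i by (rule prob_space_M)
  show "product_prob_space M" by unfold_locales
qed

context entropic_ot
begin

declare One_nat_def [simp del]

abbreviation "prodM \<equiv> PiM {1..N} M"

text \<open>The Gibbs mass of the section over \<open>x\<close> with the \<open>i\<close>-th
  potential left out. All indices are treated, since the existence proof uses the transform in every
  coordinate.\<close>

definition partial_mass :: "nat \<Rightarrow> (nat \<Rightarrow> 'a \<Rightarrow> ereal) \<Rightarrow> 'a \<Rightarrow> ennreal" where
  "partial_mass i u x = (\<integral>\<^sup>+y. exp_ext (((\<Sum>j\<in>{1..N} - {i}. u j (y j)) - ereal (c (y(i := x)))) / ereal e)
     \<partial>PiM ({1..N} - {i}) M)"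

text \<open>Real-valued, because a bounded cost keeps \<open>partial_mass\<close> strictly between
  \<open>0\<close> and \<open>\<infinity>\<close> on the dual domain.\<close>

definition transform :: "nat \<Rightarrow> (nat \<Rightarrow> 'a \<Rightarrow> ereal) \<Rightarrow> 'a \<Rightarrow> real" where
  "transform i u x = - e * ln (enn2real (partial_mass i u x))"

lemma fun_upd_in_space:
  assumes "i \<in> {1..N}" "y \<in> space (PiM ({1..N} - {i}) M)" "x \<in> space (M i)"
  shows "y(i := x) \<in> space prodM"
  using assms by (auto simp: space_PiM PiE_iff extensional_def)

lemma measurable_insert [measurable]:
  assumes "i \<in> {1..N}"
  shows "(\<lambda>(y, x). y(i := x)) \<in> PiM ({1..N} - {i}) M \<Otimes>\<^sub>M M i \<rightarrow>\<^sub>M prodM"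
  using measurable_add_dim[of i "{1..N} - {i}" M] assms by (simp add: insert_absorb)

lemma nn_integral_prodM:
  assumes i: "i \<in> {1..N}" and [measurable]: "f \<in> borel_measurable prodM"
  shows "(\<integral>\<^sup>+x. f x \<partial>prodM) = (\<integral>\<^sup>+x. (\<integral>\<^sup>+y. f (y(i := x)) \<partial>PiM ({1..N} - {i}) M) \<partial>M i)"
proof -
  have "insert i ({1..N} - {i}) = {1..N}" using i by auto
  then show ?thesis
    using product_nn_integral_insert_rev[of "{1..N} - {i}" i f] assms by simp
qed

lemma dual_dom_measurable:
  "u \<in> dual_dom N e M \<Longrightarrow> i \<in> {1..N} \<Longrightarrow> u i \<in> borel_measurable (M i)"
  by (auto simp: dual_dom_def Lexp_def)

lemma gibbs_measurable [measurable]: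
  assumes "\<And>i. i \<in> {1..N} \<Longrightarrow> u i \<in> borel_measurable (M i)"
  shows "gibbs N e c u \<in> borel_measurable prodM"
proof -
  have [measurable]: "(\<lambda>x. u i (x i)) \<in> borel_measurable prodM" if "i \<in> {1..N}" for i
    using assms[OF that] that by (rule measurable_PiM_component_rev[rotated])
  show ?thesis unfolding gibbs_def[abs_def] by measurable
qed

lemma partial_mass_measurable:
  assumes i: "i \<in> {1..N}" and u: "\<And>j. j \<in> {1..N} - {i} \<Longrightarrow> u j \<in> borel_measurable (M j)"
  shows "partial_mass i u \<in> borel_measurable (M i)"
proof -
  let ?J = "{1..N} - {i}"
  interpret J: prob_space "PiM ?J M" by (rule prob_space_PiM) (rule prob_space_M)
  have [measurable]: "(\<lambda>x. u j (snd x j)) \<in> borel_measurable (M i \<Otimes>\<^sub>M PiM ?J M)" if "j \<in> ?J" for j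
    using u[OF that] measurable_component_singleton[OF that, of M] by measurable
  have [measurable]: "(\<lambda>x. (snd x)(i := fst x)) \<in> M i \<Otimes>\<^sub>M PiM ?J M \<rightarrow>\<^sub>M prodM"
    using measurable_compose[OF measurable_pair_swap' measurable_insert[OF i]]
    by (simp add: case_prod_unfold)
  show ?thesis
    unfolding partial_mass_def[abs_def]
    by (rule J.borel_measurable_nn_integral) (simp add: case_prod_unfold, measurable)
qed

lemma partial_mass_eq:
  assumes "\<And>j y. j \<in> {1..N} - {i} \<Longrightarrow> y \<in> space (M j) \<Longrightarrow> u j y < \<infinity>"
  shows "partial_mass i u x = (\<integral>\<^sup>+y. (\<Prod>j\<in>{1..N} - {i}. exp_ext (u j (y j) / ereal e)) *
      ennreal (exp (- c (y(i := x)) / e)) \<partial>PiM ({1..N} - {i}) M)"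
  unfolding partial_mass_def
  using assms e_pos
  by (intro nn_integral_cong exp_ext_div_eq_prod) (auto simp: space_PiM PiE_iff less_top)

lemma gibbs_fun_upd:
  assumes i: "i \<in> {1..N}" and x: "x \<in> space (M i)" and y: "y \<in> space (PiM ({1..N} - {i}) M)"
    and v: "v \<in> dual_dom N e M"
  shows "gibbs N e c v (y(i := x)) = exp_ext (v i x / ereal e) *
    ((\<Prod>j\<in>{1..N} - {i}. exp_ext (v j (y j) / ereal e)) * ennreal (exp (- c (y(i := x)) / e)))"
proof -
  let ?z = "y(i := x)"
  have "\<And>j. j \<in> {1..N} \<Longrightarrow> v j (?z j) \<noteq> \<infinity>"
    using fun_upd_in_space[OF i y x] v by (auto simp: space_PiM PiE_iff dual_dom_def Lexp_def)
  then have "gibbs N e c v ?z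
      = (\<Prod>j\<in>{1..N}. exp_ext (v j (?z j) / ereal e)) * ennreal (exp (- c ?z / e))"
    unfolding gibbs_def using e_pos by (intro exp_ext_div_eq_prod) auto
  also have "(\<Prod>j\<in>{1..N}. exp_ext (v j (?z j) / ereal e))
      = exp_ext (v i x / ereal e) * (\<Prod>j\<in>{1..N} - {i}. exp_ext (v j (?z j) / ereal e))"
    using i by (subst prod.remove[of _ i]) auto
  also have "(\<Prod>j\<in>{1..N} - {i}. exp_ext (v j (?z j) / ereal e))
      = (\<Prod>j\<in>{1..N} - {i}. exp_ext (v j (y j) / ereal e))"
    by (intro prod.cong) auto
  finally show ?thesis by (simp only: mult.assoc)
qed

text \<open>Tonelli with the \<open>i\<close>-th variable outermost: on a section the factor of the
  \<open>i\<close>-th potential is constant. As \<open>u\<close> and \<open>v\<close> may differ at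
  \<open>i\<close>, one partial mass serves all replacements of that potential.\<close>

lemma nn_integral_gibbs:
  assumes i: "i \<in> {1..N}" and v: "v \<in> dual_dom N e M"
    and u: "\<And>j. j \<in> {1..N} - {i} \<Longrightarrow> u j = v j"
  shows "(\<integral>\<^sup>+x. gibbs N e c v x \<partial>prodM)
    = (\<integral>\<^sup>+x. exp_ext (v i x / ereal e) * partial_mass i u x \<partial>M i)"
proof -
  let ?J = "{1..N} - {i}"
  note [measurable] = dual_dom_measurable[OF v]
  have "(\<integral>\<^sup>+x. gibbs N e c v x \<partial>prodM)
      = (\<integral>\<^sup>+x. (\<integral>\<^sup>+y. gibbs N e c v (y(i := x)) \<partial>PiM ?J M) \<partial>M i)"
    by (rule nn_integral_prodM[OF i]) measurable
  also have "\<dots> = (\<integral>\<^sup>+x. exp_ext (v i x / ereal e) * partial_mass i u x \<partial>M i)"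
  proof (rule nn_integral_cong)
    fix x assume x: "x \<in> space (M i)"
    have [measurable]: "(\<lambda>y. v j (y j)) \<in> borel_measurable (PiM ?J M)" if "j \<in> ?J" for j
      using measurable_component_singleton[OF that, of M] dual_dom_measurable[OF v, of j] that
      by (auto intro: measurable_compose)
    have [measurable]: "(\<lambda>y. y(i := x)) \<in> PiM ?J M \<rightarrow>\<^sub>M prodM"
      using measurable_compose[OF measurable_Pair1'[OF x] measurable_compose[OF measurable_pair_swap' measurable_insert[OF i]]]
      by (simp add: case_prod_unfold)
    have "(\<integral>\<^sup>+y. gibbs N e c v (y(i := x)) \<partial>PiM ?J M)
        = (\<integral>\<^sup>+y. exp_ext (v i x / ereal e) * ((\<Prod>j\<in>?J. exp_ext (v j (y j) / ereal e)) *
            ennreal (exp (- c (y(i := x)) / e))) \<partial>PiM ?J M)"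
      using i x v by (intro nn_integral_cong gibbs_fun_upd)
    also have "\<dots> = exp_ext (v i x / ereal e) * (\<integral>\<^sup>+y. (\<Prod>j\<in>?J. exp_ext (v j (y j) / ereal e)) *
            ennreal (exp (- c (y(i := x)) / e)) \<partial>PiM ?J M)"
      by (intro nn_integral_cmult) measurable
    also have "(\<integral>\<^sup>+y. (\<Prod>j\<in>?J. exp_ext (v j (y j) / ereal e)) *
            ennreal (exp (- c (y(i := x)) / e)) \<partial>PiM ?J M) = partial_mass i v x"
      using v by (intro partial_mass_eq[symmetric]) (auto simp: dual_dom_def Lexp_def)
    also have "partial_mass i v x = partial_mass i u x"
      unfolding partial_mass_def using u by simp
    finally show "(\<integral>\<^sup>+y. gibbs N e c v (y(i := x)) \<partial>PiM ?J M)
        = exp_ext (v i x / ereal e) * partial_mass i u x" .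
  qed
  finally show ?thesis .
qed

definition mass_others :: "nat \<Rightarrow> (nat \<Rightarrow> 'a \<Rightarrow> ereal) \<Rightarrow> real" where
  "mass_others i u = enn2real (\<Prod>j\<in>{1..N} - {i}. \<integral>\<^sup>+x. exp_ext (u j x / ereal e) \<partial>M j)"

lemma mass_others:
  assumes u: "u \<in> dual_dom N e M"
  shows "(\<Prod>j\<in>{1..N} - {i}. \<integral>\<^sup>+x. exp_ext (u j x / ereal e) \<partial>M j) = ennreal (mass_others i u)"
    and "mass_others i u > 0"
proof -
  have "0 < (\<integral>\<^sup>+x. exp_ext (u j x / ereal e) \<partial>M j)" "(\<integral>\<^sup>+x. exp_ext (u j x / ereal e) \<partial>M j) < \<infinity>"
    if "j \<in> {1..N}" for j
    using u that by (auto simp: dual_dom_def Lexp_def)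
  then have "(\<Prod>j\<in>{1..N} - {i}. \<integral>\<^sup>+x. exp_ext (u j x / ereal e) \<partial>M j) \<noteq> 0"
    "(\<Prod>j\<in>{1..N} - {i}. \<integral>\<^sup>+x. exp_ext (u j x / ereal e) \<partial>M j) \<noteq> \<infinity>"
    by (fastforce simp: prod_zero_iff ennreal_prod_eq_top)+
  then show "(\<Prod>j\<in>{1..N} - {i}. \<integral>\<^sup>+x. exp_ext (u j x / ereal e) \<partial>M j) = ennreal (mass_others i u)"
    and "mass_others i u > 0"
    unfolding mass_others_def by (auto simp: less_top enn2real_positive_iff zero_less_iff_neq_zero)
qed

text \<open>The factor \<open>exp (- c / e)\<close> lies between \<open>exp (- B / e)\<close> and
  \<open>exp (B / e)\<close>; what remains is a product of functions of separate variables, whose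
  integral factorizes into \<open>mass_others\<close>.\<close>

lemma partial_mass_bounds:
  assumes i: "i \<in> {1..N}" and u: "u \<in> dual_dom N e M" and x: "x \<in> space (M i)"
  shows "ennreal (exp (- B / e) * mass_others i u) \<le> partial_mass i u x"
    and "partial_mass i u x \<le> ennreal (exp (B / e) * mass_others i u)"
proof -
  let ?J = "{1..N} - {i}"
  let ?f = "\<lambda>y. \<Prod>j\<in>?J. exp_ext (u j (y j) / ereal e)"
  have [measurable]: "(\<lambda>y. u j (y j)) \<in> borel_measurable (PiM ?J M)" if "j \<in> ?J" for j
    using measurable_component_singleton[OF that, of M] dual_dom_measurable[OF u, of j] that
    by (auto intro: measurable_compose)
  have [measurable]: "?f \<in> borel_measurable (PiM ?J M)" by measurable
  have f: "(\<integral>\<^sup>+y. ?f y \<partial>PiM ?J M) = ennreal (mass_others i u)"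
    unfolding mass_others(1)[OF u, symmetric]
  proof (rule product_nn_integral_prod)
    show "(\<lambda>x. exp_ext (u j x / ereal e)) \<in> borel_measurable (M j)" if "j \<in> ?J" for j
    proof -
      have [measurable]: "u j \<in> borel_measurable (M j)" using dual_dom_measurable[OF u, of j] that by auto
      show ?thesis by measurable
    qed
  qed simp
  have Z: "partial_mass i u x = (\<integral>\<^sup>+y. ?f y * ennreal (exp (- c (y(i := x)) / e)) \<partial>PiM ?J M)"
    using u by (intro partial_mass_eq) (auto simp: dual_dom_def Lexp_def)
  have b: "- B / e \<le> - c (y(i := x)) / e" "- c (y(i := x)) / e \<le> B / e" if "y \<in> space (PiM ?J M)" for y
    using c_bounded[OF fun_upd_in_space[OF i that x]] e_pos
      divide_right_mono[of "- c (y(i := x))" B e] by (auto intro!: divide_right_mono)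
  note pos = less_imp_le[OF mass_others(2)[OF u]]
  have "ennreal (exp (- B / e) * mass_others i u) = (\<integral>\<^sup>+y. ?f y * ennreal (exp (- B / e)) \<partial>PiM ?J M)"
    using pos by (subst nn_integral_multc) (auto simp: f ennreal_mult mult.commute)
  also have "\<dots> \<le> partial_mass i u x"
    unfolding Z using b(1) by (intro nn_integral_mono mult_left_mono ennreal_leI) auto
  finally show "ennreal (exp (- B / e) * mass_others i u) \<le> partial_mass i u x" .
  have "partial_mass i u x \<le> (\<integral>\<^sup>+y. ?f y * ennreal (exp (B / e)) \<partial>PiM ?J M)"
    unfolding Z using b(2) by (intro nn_integral_mono mult_left_mono ennreal_leI) auto
  also have "\<dots> = ennreal (exp (B / e) * mass_others i u)"
    using pos by (subst nn_integral_multc) (auto simp: f ennreal_mult mult.commute)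
  finally show "partial_mass i u x \<le> ennreal (exp (B / e) * mass_others i u)" .
qed

text \<open>Logarithm of the two-sided bound. The potentials enter only through the constant
  \<open>mass_others i u\<close>, while the radius \<open>B\<close> is universal; this uniformity
  drives the existence proof.\<close>

lemma partial_mass_transform:
  assumes i: "i \<in> {1..N}" and u: "u \<in> dual_dom N e M" and x: "x \<in> space (M i)"
  shows "partial_mass i u x = ennreal (exp (- transform i u x / e))"
    and "\<bar>transform i u x + e * ln (mass_others i u)\<bar> \<le> B"
proof -
  note b = partial_mass_bounds[OF assms]
  note pos = mass_others(2)[OF u, of i]
  obtain r where r: "partial_mass i u x = ennreal r" "0 \<le> r"
    using b(2) by (cases "partial_mass i u x") (auto simp: top_unique)
  have r1: "exp (- B / e) * mass_others i u \<le> r"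
    using b(1) r by (simp add: ennreal_le_iff)
  have r2: "r \<le> exp (B / e) * mass_others i u"
    using b(2) r pos by (simp add: ennreal_le_iff)
  have r0: "0 < r" using r1 pos by (smt (verit) exp_gt_zero mult_pos_pos)
  have t: "transform i u x = - e * ln r" unfolding transform_def using r by simp
  show "partial_mass i u x = ennreal (exp (- transform i u x / e))"
    using t r r0 e_pos by simp
  have "- B / e + ln (mass_others i u) \<le> ln r"
    using r1 r0 pos ln_mono[OF r1] by (simp add: ln_mult)
  moreover have "ln r \<le> B / e + ln (mass_others i u)"
    using r2 r0 pos ln_mono[OF r2 r0] by (simp add: ln_mult)
  ultimately have "- B \<le> e * (ln r - ln (mass_others i u))" "e * (ln r - ln (mass_others i u)) \<le> B"
    using e_pos by (auto simp: field_simps)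
  then show "\<bar>transform i u x + e * ln (mass_others i u)\<bar> \<le> B"
    using t by (auto simp: algebra_simps abs_le_iff)
qed

lemma transform_measurable:
  assumes "i \<in> {1..N}" "u \<in> dual_dom N e M"
  shows "transform i u \<in> borel_measurable (M i)"
proof -
  have [measurable]: "partial_mass i u \<in> borel_measurable (M i)"
    using assms by (intro partial_mass_measurable dual_dom_measurable) auto
  show ?thesis unfolding transform_def[abs_def] by measurable
qed

lemma bounded_in_Lexp:
  assumes [measurable]: "h \<in> borel_measurable (M i)" and b: "\<And>x. x \<in> space (M i) \<Longrightarrow> \<bar>h x\<bar> \<le> R"
  shows "(\<lambda>x. ereal (h x)) \<in> Lexp e (M i)"
proof -
  interpret prob_space "M i" by (rule prob_space_M)
  have b': "- R / e \<le> h x / e" "h x / e \<le> R / e" if "x \<in> space (M i)" for x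
    using b[OF that] e_pos divide_right_mono[of "- R" "h x" e] by (auto intro!: divide_right_mono)
  have "ennreal (exp (- R / e)) = (\<integral>\<^sup>+x. ennreal (exp (- R / e)) \<partial>M i)"
    by (simp add: M.emeasure_space_1)
  also have "\<dots> \<le> (\<integral>\<^sup>+x. ennreal (exp (h x / e)) \<partial>M i)"
    using b'(1) by (intro nn_integral_mono ennreal_leI) auto
  finally have 1: "0 < (\<integral>\<^sup>+x. ennreal (exp (h x / e)) \<partial>M i)"
    using order.strict_trans2[of 0 "ennreal (exp (- R / e))"] by simp
  have "(\<integral>\<^sup>+x. ennreal (exp (h x / e)) \<partial>M i) \<le> (\<integral>\<^sup>+x. ennreal (exp (R / e)) \<partial>M i)"
    using b'(2) by (intro nn_integral_mono ennreal_leI) auto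
  also have "\<dots> < \<infinity>" by (simp add: M.emeasure_space_1)
  finally show ?thesis using 1 e_pos by (simp add: Lexp_def)
qed

lemma transform_bounded:
  assumes "i \<in> {1..N}" "u \<in> dual_dom N e M" "x \<in> space (M i)"
  shows "\<bar>transform i u x\<bar> \<le> B + \<bar>e * ln (mass_others i u)\<bar>"
  using partial_mass_transform(2)[OF assms] by linarith

lemma transform_in_Lexp:
  assumes "i \<in> {1..N}" "u \<in> dual_dom N e M"
  shows "(\<lambda>x. ereal (transform i u x)) \<in> Lexp e (M i)"
  using transform_bounded[OF assms] transform_measurable[OF assms] by (rule bounded_in_Lexp[rotated])

end

section \<open>The dual functional\<close>

lemma exp_diff_linear_nonneg: "0 \<le> exp t - 1 - (t :: real)"
  using exp_ge_add_one_self[of t] by linarith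

text \<open>Squaring \<open>1 + t / 2 \<le> exp (t / 2)\<close> gains a term
  \<open>t * t / 4\<close> over the linear bound, and \<open>exp t = 1 + t\<close> leaves no room
  for it.\<close>

lemma exp_diff_linear_eq_0_iff: "exp t - 1 - (t :: real) = 0 \<longleftrightarrow> t = 0"
proof
  assume t: "exp t - 1 - t = 0"
  \<comment> \<open>Squaring requires a nonnegative left side; \<open>1 + t = exp t > 0\<close>
    provides it.\<close>
  have "0 \<le> 1 + t / 2" using t exp_gt_zero[of t] by linarith
  then have "(1 + t / 2)\<^sup>2 \<le> (exp (t / 2))\<^sup>2" by (intro power_mono) auto
  also have "\<dots> = exp t" by (simp add: power2_eq_square exp_add[symmetric])
  finally have "t * t \<le> 0" using t by (simp add: power2_eq_square algebra_simps)
  then show "t = 0" using zero_le_square[of t] by (metis antisym mult_eq_0_iff)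
qed simp

lemma sum_ereal_MInf:
  fixes a :: "'i \<Rightarrow> ereal"
  assumes "finite J" "\<And>j. j \<in> J \<Longrightarrow> a j \<noteq> \<infinity>" "k \<in> J" "a k = -\<infinity>"
  shows "sum a J = -\<infinity>"
proof -
  have "sum a (J - {k}) \<noteq> \<infinity>" using assms by (auto simp: sum_Pinfty)
  then show ?thesis using assms by (simp add: sum.remove[of J k])
qed

context entropic_ot
begin

text \<open>Bounding the partial mass in the first variable by a constant leaves an exponential
  integral of \<open>u 1\<close>, finite by membership in \<open>Lexp\<close>.\<close>

lemma nn_integral_gibbs_finite:
  assumes u: "u \<in> dual_dom N e M"
  shows "(\<integral>\<^sup>+x. gibbs N e c u x \<partial>prodM) < \<infinity>"
proof -
  have 1: "1 \<in> {1..N}" using N_pos by simp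
  have [measurable]: "u 1 \<in> borel_measurable (M 1)" using dual_dom_measurable[OF u 1] .
  have "(\<integral>\<^sup>+x. gibbs N e c u x \<partial>prodM) = (\<integral>\<^sup>+x. exp_ext (u 1 x / ereal e) * partial_mass 1 u x \<partial>M 1)"
    using 1 u by (intro nn_integral_gibbs) auto
  also have "\<dots> \<le> (\<integral>\<^sup>+x. exp_ext (u 1 x / ereal e) * ennreal (exp (B / e) * mass_others 1 u) \<partial>M 1)"
    using partial_mass_bounds(2)[OF 1 u] by (intro nn_integral_mono mult_left_mono) auto
  also have "\<dots> = (\<integral>\<^sup>+x. exp_ext (u 1 x / ereal e) \<partial>M 1) * ennreal (exp (B / e) * mass_others 1 u)"
    by (intro nn_integral_multc) measurable
  also have "\<dots> < \<infinity>"
    using u 1 by (auto simp: dual_dom_def Lexp_def ennreal_mult_less_top)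
  finally show ?thesis .
qed

lemma dual_dom_fun_upd:
  "u \<in> dual_dom N e M \<Longrightarrow> h \<in> Lexp e (M i) \<Longrightarrow> u(i := h) \<in> dual_dom N e M"
  by (auto simp: dual_dom_def)

lemma ext_integral_not_top:
  "u \<in> dual_dom N e M \<Longrightarrow> i \<in> {1..N} \<Longrightarrow> ext_integral (M i) (u i) \<noteq> \<infinity>"
  using ext_integral_Lexp_not_top[OF e_pos, of "u i" "M i"] by (simp add: dual_dom_def)

lemma dual_eq:
  assumes u: "u \<in> dual_dom N e M"
  shows "dual N e c M u = (\<Sum>i\<in>{1..N}. ext_integral (M i) (u i))
    - ereal (e * enn2real (\<integral>\<^sup>+x. gibbs N e c u x \<partial>prodM))"
  using nn_integral_gibbs_finite[OF u] unfolding dual_def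
  by (cases "\<integral>\<^sup>+x. gibbs N e c u x \<partial>prodM") auto

lemma dual_less_top:
  assumes u: "u \<in> dual_dom N e M"
  shows "dual N e c M u < \<infinity>"
proof -
  have "(\<Sum>i\<in>{1..N}. ext_integral (M i) (u i)) \<noteq> \<infinity>"
    using ext_integral_not_top[OF u] by (auto simp: sum_Pinfty)
  then show ?thesis unfolding dual_eq[OF u]
    by (cases "\<Sum>i\<in>{1..N}. ext_integral (M i) (u i)") auto
qed

lemma dual_eq_MInf_iff:
  assumes u: "u \<in> dual_dom N e M"
  shows "dual N e c M u = -\<infinity> \<longleftrightarrow> (\<exists>i\<in>{1..N}. ext_integral (M i) (u i) = -\<infinity>)"
proof
  assume "\<exists>i\<in>{1..N}. ext_integral (M i) (u i) = -\<infinity>"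
  then have "(\<Sum>i\<in>{1..N}. ext_integral (M i) (u i)) = -\<infinity>"
    using ext_integral_not_top[OF u] sum_ereal_MInf[of "{1..N}" "\<lambda>i. ext_integral (M i) (u i)"] by auto
  then show "dual N e c M u = -\<infinity>" unfolding dual_eq[OF u] by simp
next
  assume d: "dual N e c M u = -\<infinity>"
  show "\<exists>i\<in>{1..N}. ext_integral (M i) (u i) = -\<infinity>"
  proof (rule ccontr)
    assume "\<not> ?thesis"
    then have "\<bar>\<Sum>i\<in>{1..N}. ext_integral (M i) (u i)\<bar> \<noteq> \<infinity>"
      using ext_integral_not_top[OF u] by (subst sum_Inf) auto
    then show False using d unfolding dual_eq[OF u] by auto
  qed
qed

lemma gibbs_cong_AE:
  assumes "\<And>i. i \<in> {1..N} \<Longrightarrow> AE x in M i. u i x = v i x"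
  shows "AE x in prodM. gibbs N e c u x = gibbs N e c v x"
proof -
  have "AE x in prodM. \<forall>i\<in>{1..N}. u i (x i) = v i (x i)"
    using assms by (intro eventually_ball_finite ballI AE_component) auto
  then show ?thesis
  proof eventually_elim
    case (elim x)
    then have "(\<Sum>i\<in>{1..N}. u i (x i)) = (\<Sum>i\<in>{1..N}. v i (x i))" by (intro sum.cong) auto
    then show ?case by (simp add: gibbs_def)
  qed
qed

lemma dual_cong_AE:
  assumes "\<And>i. i \<in> {1..N} \<Longrightarrow> AE x in M i. u i x = v i x"
  shows "dual N e c M u = dual N e c M v"
proof -
  have "ext_integral (M i) (u i) = ext_integral (M i) (v i)" if "i \<in> {1..N}" for i
    using assms[OF that] by (rule ext_integral_cong_AE)
  moreover have "(\<integral>\<^sup>+x. gibbs N e c u x \<partial>prodM) = (\<integral>\<^sup>+x. gibbs N e c v x \<partial>prodM)"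
    by (intro nn_integral_cong_AE gibbs_cong_AE assms)
  ultimately show ?thesis unfolding dual_def by simp
qed

section \<open>Real-valued potentials and their Gibbs density\<close>

definition osum :: "(nat \<Rightarrow> 'a \<Rightarrow> real) \<Rightarrow> (nat \<Rightarrow> 'a) \<Rightarrow> real" where
  "osum r x = (\<Sum>i\<in>{1..N}. r i (x i))"

definition gibbs_real :: "(nat \<Rightarrow> 'a \<Rightarrow> real) \<Rightarrow> (nat \<Rightarrow> 'a) \<Rightarrow> real" where
  "gibbs_real r x = exp ((osum r x - c x) / e)"

lemma osum_measurable [measurable]:
  assumes "\<And>i. i \<in> {1..N} \<Longrightarrow> r i \<in> borel_measurable (M i)"
  shows "osum r \<in> borel_measurable prodM"
proof -
  have [measurable]: "(\<lambda>x. r i (x i)) \<in> borel_measurable prodM" if "i \<in> {1..N}" for i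
    using assms[OF that] that by (rule measurable_PiM_component_rev[rotated])
  show ?thesis unfolding osum_def[abs_def] by measurable
qed

lemma gibbs_real_measurable [measurable]:
  assumes [measurable]: "\<And>i. i \<in> {1..N} \<Longrightarrow> r i \<in> borel_measurable (M i)"
  shows "gibbs_real r \<in> borel_measurable prodM"
  unfolding gibbs_real_def[abs_def] by measurable

lemma gibbs_ereal: "gibbs N e c (\<lambda>i x. ereal (r i x)) x = ennreal (gibbs_real r x)"
  unfolding gibbs_def gibbs_real_def osum_def using e_pos by simp

text \<open>A dual value above \<open>-\<infinity>\<close> forces every potential to be integrable,
  hence real almost everywhere. Such tuples can then be treated by real arithmetic, with extended
  values confined to null sets.\<close>

lemma dual_finite:
  assumes u: "u \<in> dual_dom N e M" and fin: "dual N e c M u \<noteq> -\<infinity>"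
  defines "r \<equiv> \<lambda>i x. real_of_ereal (u i x)"
  shows "\<And>i. i \<in> {1..N} \<Longrightarrow> AE x in M i. u i x = ereal (r i x)"
    and "\<And>i. i \<in> {1..N} \<Longrightarrow> integrable (M i) (r i)"
    and "AE x in prodM. gibbs N e c u x = ennreal (gibbs_real r x)"
    and "integrable prodM (gibbs_real r)"
    and "dual N e c M u = ereal ((\<Sum>i\<in>{1..N}. \<integral>x. r i x \<partial>M i) - e * (\<integral>x. gibbs_real r x \<partial>prodM))"
proof -
  have ext: "ext_integral (M i) (u i) \<noteq> -\<infinity>" if "i \<in> {1..N}" for i
    using fin dual_eq_MInf_iff[OF u] that by auto
  have L: "u i \<in> Lexp e (M i)" if "i \<in> {1..N}" for i using u that by (auto simp: dual_dom_def)
  show *: "AE x in M i. u i x = ereal (r i x)" and int: "integrable (M i) (r i)" if "i \<in> {1..N}" for i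
    using Lexp_finite_integral(1,2)[OF e_pos L ext] that unfolding r_def by auto
  show g: "AE x in prodM. gibbs N e c u x = ennreal (gibbs_real r x)"
    using gibbs_cong_AE[OF *] by (simp add: gibbs_ereal)
  have [measurable]: "r i \<in> borel_measurable (M i)" if "i \<in> {1..N}" for i using int[OF that] by auto
  have "(\<integral>\<^sup>+x. ennreal (gibbs_real r x) \<partial>prodM) = (\<integral>\<^sup>+x. gibbs N e c u x \<partial>prodM)"
    using g by (intro nn_integral_cong_AE) auto
  then have m: "(\<integral>\<^sup>+x. ennreal (gibbs_real r x) \<partial>prodM) < \<infinity>"
    and m': "enn2real (\<integral>\<^sup>+x. gibbs N e c u x \<partial>prodM) = (\<integral>x. gibbs_real r x \<partial>prodM)"
    using nn_integral_gibbs_finite[OF u]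
    by (auto simp: integral_eq_nn_integral gibbs_real_def)
  show "integrable prodM (gibbs_real r)"
    using m by (intro integrableI_bounded) (auto simp: gibbs_real_def)
  have "(\<Sum>i\<in>{1..N}. ext_integral (M i) (u i)) = (\<Sum>i\<in>{1..N}. ereal (\<integral>x. r i x \<partial>M i))"
    using Lexp_finite_integral(3)[OF e_pos L ext] by (intro sum.cong) (auto simp: r_def)
  then show "dual N e c M u = ereal ((\<Sum>i\<in>{1..N}. \<integral>x. r i x \<partial>M i) - e * (\<integral>x. gibbs_real r x \<partial>prodM))"
    unfolding dual_eq[OF u] m' by simp
qed

text \<open>\<open>partial_mass\<close> is \<open>exp (- transform i u x / e)\<close>, which reduces
  the mass on the product to an integral in one variable; when \<open>v\<close> is the transform
  itself, the integrand is \<open>1\<close>.\<close>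

lemma transform_mass:
  assumes i: "i \<in> {1..N}" and u: "u \<in> dual_dom N e M"
    and v: "v \<in> Lexp e (M i)"
  shows "(\<integral>\<^sup>+x. gibbs N e c (u(i := v)) x \<partial>prodM)
    = (\<integral>\<^sup>+x. exp_ext ((v x - ereal (transform i u x)) / ereal e) \<partial>M i)"
proof -
  have "(\<integral>\<^sup>+x. gibbs N e c (u(i := v)) x \<partial>prodM)
      = (\<integral>\<^sup>+x. exp_ext ((u(i := v)) i x / ereal e) * partial_mass i u x \<partial>M i)"
    using i by (intro nn_integral_gibbs dual_dom_fun_upd u v) auto
  also have "\<dots> = (\<integral>\<^sup>+x. exp_ext ((v x - ereal (transform i u x)) / ereal e) \<partial>M i)"
  proof (rule nn_integral_cong)
    fix x assume x: "x \<in> space (M i)"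
    then have "v x \<noteq> \<infinity>" using v by (auto simp: Lexp_def)
    then show "exp_ext ((u(i := v)) i x / ereal e) * partial_mass i u x
        = exp_ext ((v x - ereal (transform i u x)) / ereal e)"
      using exp_ext_div_eq_prod[OF e_pos, of "{i}" "\<lambda>_. v x" "transform i u x"]
      by (simp add: partial_mass_transform(1)[OF i u x])
  qed
  finally show ?thesis .
qed

lemma dual_transform:
  assumes i: "i \<in> {1..N}" and u: "u \<in> dual_dom N e M" and fin: "dual N e c M u \<noteq> -\<infinity>"
  defines "t \<equiv> \<lambda>x. (real_of_ereal (u i x) - transform i u x) / e"
  shows "integrable (M i) (\<lambda>x. exp (t x) - 1 - t x)"
    and "dual N e c M (u(i := \<lambda>x. ereal (transform i u x)))
      = dual N e c M u + ereal (e * (\<integral>x. exp (t x) - 1 - t x \<partial>M i))"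
proof -
  define h where "h = transform i u"
  define r where "r = (\<lambda>i x. real_of_ereal (u i x))"
  define m where "m = enn2real (\<integral>\<^sup>+x. gibbs N e c u x \<partial>prodM)"
  let ?v = "u(i := \<lambda>x. ereal (h x))"
  have h_L: "(\<lambda>x. ereal (h x)) \<in> Lexp e (M i)" unfolding h_def by (rule transform_in_Lexp[OF i u])
  have v: "?v \<in> dual_dom N e M" by (rule dual_dom_fun_upd[OF u h_L])
  have L: "u j \<in> Lexp e (M j)" if "j \<in> {1..N}" for j using u that by (auto simp: dual_dom_def)
  have [measurable]: "h \<in> borel_measurable (M i)" unfolding h_def by (rule transform_measurable[OF i u])
  have h_int: "integrable (M i) h"
  proof (rule M.integrable_const_bound)
    show "AE x in M i. norm (h x) \<le> B + \<bar>e * ln (mass_others i u)\<bar>"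
      using transform_bounded[OF i u] by (auto simp: h_def)
  qed simp
  have ext: "ext_integral (M j) (u j) \<noteq> -\<infinity>" if "j \<in> {1..N}" for j
    using fin dual_eq_MInf_iff[OF u] that by auto
  have r_int: "integrable (M i) (r i)" and r_ae: "AE x in M i. u i x = ereal (r i x)"
    using Lexp_finite_integral(1,2)[OF e_pos L ext] i unfolding r_def by auto
  have [measurable]: "r i \<in> borel_measurable (M i)" using r_int by auto
  have "(\<integral>\<^sup>+x. ennreal (exp (t x)) \<partial>M i) = (\<integral>\<^sup>+x. exp_ext ((u i x - ereal (h x)) / ereal e) \<partial>M i)"
    using r_ae
  proof (intro nn_integral_cong_AE, eventually_elim)
    case (elim x)
    show ?case unfolding elim using e_pos by (simp add: t_def h_def r_def)
  qed
  also have "\<dots> = (\<integral>\<^sup>+x. gibbs N e c u x \<partial>prodM)"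
    using transform_mass[OF i u L[OF i]] by (simp add: h_def)
  finally have mass: "(\<integral>\<^sup>+x. ennreal (exp (t x)) \<partial>M i) = (\<integral>\<^sup>+x. gibbs N e c u x \<partial>prodM)" .
  have t_meas [measurable]: "t \<in> borel_measurable (M i)"
    using \<open>r i \<in> _\<close> unfolding t_def h_def[symmetric] r_def by measurable
  have t_int: "integrable (M i) t"
    using r_int h_int unfolding t_def h_def[symmetric] r_def by simp
  have exp_int: "integrable (M i) (\<lambda>x. exp (t x))"
    using nn_integral_gibbs_finite[OF u] mass by (intro integrableI_bounded) auto
  have m: "m = (\<integral>x. exp (t x) \<partial>M i)"
    unfolding m_def mass[symmetric] by (subst integral_eq_nn_integral) auto
  show int: "integrable (M i) (\<lambda>x. exp (t x) - 1 - t x)" using t_int exp_int by simp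
  have mv: "enn2real (\<integral>\<^sup>+x. gibbs N e c ?v x \<partial>prodM) = 1"
    using transform_mass[OF i u h_L] e_pos by (simp add: h_def[symmetric] M.emeasure_space_1 exp_ext_def)
  \<comment> \<open>The summands untouched by the replacement; being finite, they cancel in the
    difference of the two dual values.\<close>
  define S where "S = (\<Sum>j\<in>{1..N} - {i}. ext_integral (M j) (u j))"
  have "\<bar>S\<bar> \<noteq> \<infinity>" unfolding S_def using ext ext_integral_not_top[OF u] by (subst sum_Inf) auto
  then obtain s where s: "S = ereal s" by (cases S) auto
  have du: "dual N e c M u = ereal ((\<integral>x. r i x \<partial>M i) + s - e * m)"
    unfolding dual_eq[OF u] m_def[symmetric]
    using i Lexp_finite_integral(3)[OF e_pos L[OF i] ext[OF i]] s
    by (subst sum.remove[of _ i]) (auto simp: S_def r_def)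
  have dv: "dual N e c M ?v = ereal ((\<integral>x. h x \<partial>M i) + s - e)"
    unfolding dual_eq[OF v] mv
    using i ext_integral_real[OF h_int] s
    by (subst sum.remove[of _ i]) (auto simp: S_def)
  have "(\<integral>x. exp (t x) - 1 - t x \<partial>M i) = m - 1 - (\<integral>x. t x \<partial>M i)"
    using t_int exp_int by (simp add: m M.prob_space)
  also have "(\<integral>x. t x \<partial>M i) = ((\<integral>x. r i x \<partial>M i) - (\<integral>x. h x \<partial>M i)) / e"
    using r_int h_int unfolding t_def h_def[symmetric] r_def by simp
  finally have "e * (\<integral>x. exp (t x) - 1 - t x \<partial>M i)
      = e * m - e - ((\<integral>x. r i x \<partial>M i) - (\<integral>x. h x \<partial>M i))"
    using e_pos by (simp add: field_simps)
  then show "dual N e c M (u(i := \<lambda>x. ereal (transform i u x)))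
      = dual N e c M u + ereal (e * (\<integral>x. exp (t x) - 1 - t x \<partial>M i))"
    using du dv unfolding h_def by simp
qed

lemma dual_le_dual_transform:
  assumes i: "i \<in> {1..N}" and u: "u \<in> dual_dom N e M"
  shows "dual N e c M u \<le> dual N e c M (u(i := \<lambda>x. ereal (transform i u x)))"
proof (cases "dual N e c M u = -\<infinity>")
  case False
  show ?thesis
    unfolding dual_transform(2)[OF i u False] using e_pos
    by (intro ereal_le_add_self) (auto intro!: mult_nonneg_nonneg integral_nonneg_AE AE_I2 exp_diff_linear_nonneg)
qed simp

text \<open>The gain is the integral of the nonnegative function \<open>exp t - 1 - t\<close>, whose
  only zero is \<open>t = 0\<close>; finiteness of the dual value permits cancelling it.\<close>

lemma dual_transform_eq_imp:
  assumes i: "i \<in> {1..N}" and u: "u \<in> dual_dom N e M"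
    and fin: "dual N e c M u \<noteq> -\<infinity>"
    and eq: "dual N e c M (u(i := \<lambda>x. ereal (transform i u x))) = dual N e c M u"
  shows "AE x in M i. u i x = ereal (transform i u x)"
proof -
  define t where "t = (\<lambda>x. (real_of_ereal (u i x) - transform i u x) / e)"
  have int: "integrable (M i) (\<lambda>x. exp (t x) - 1 - t x)"
    unfolding t_def using dual_transform(1)[OF i u fin] .
  have "(\<integral>x. exp (t x) - 1 - t x \<partial>M i) = 0"
    unfolding t_def using dual_transform(2)[OF i u fin] eq fin dual_less_top[OF u] e_pos
    by (cases "dual N e c M u") auto
  then have "AE x in M i. exp (t x) - 1 - t x = 0"
    using integral_nonneg_eq_0_iff_AE[OF int] exp_diff_linear_nonneg by auto
  moreover have "AE x in M i. u i x = ereal (real_of_ereal (u i x))"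
    using dual_finite(1)[OF u fin i] .
  ultimately show ?thesis
  proof eventually_elim
    case (elim x)
    have "t x = 0" using elim(1) exp_diff_linear_eq_0_iff by blast
    then have "real_of_ereal (u i x) = transform i u x" using e_pos by (simp add: t_def)
    then show ?case using elim(2) by simp
  qed
qed

end

section \<open>Bounded potentials\<close>

text \<open>The midpoint defect of \<open>exp\<close> is exactly half the square of
  \<open>exp (a / 2) - exp (b / 2)\<close>, and on \<open>[-K, K]\<close> the function
  \<open>exp (x / 2)\<close> has slope at least \<open>exp (- K / 2) / 2\<close>.\<close>

lemma exp_midpoint_strong_convex:
  fixes a b K :: real
  assumes "\<bar>a\<bar> \<le> K" "\<bar>b\<bar> \<le> K"
  shows "exp ((a + b) / 2) + exp (- K) * (a - b)\<^sup>2 / 8 \<le> (exp a + exp b) / 2"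
proof -
  \<comment> \<open>The slope bound: factor out \<open>exp (y / 2)\<close>, which is at least
    \<open>exp (- K / 2)\<close>, and use \<open>s \<le> exp s - 1\<close>.\<close>
  have *: "exp (- K / 2) * ((x - y) / 2) \<le> exp (x / 2) - exp (y / 2)" if "y \<le> x" "\<bar>y\<bar> \<le> K" for x y :: real
  proof -
    have "exp (- K / 2) * ((x - y) / 2) \<le> exp (y / 2) * (exp ((x - y) / 2) - 1)"
    proof (intro mult_mono)
      show "(x - y) / 2 \<le> exp ((x - y) / 2) - 1"
        using exp_ge_add_one_self[of "(x - y) / 2"] by linarith
    qed (use that in auto)
    also have "\<dots> = exp (x / 2) - exp (y / 2)"
      by (simp add: algebra_simps exp_add[symmetric] diff_divide_distrib)
    finally show ?thesis .
  qed
  have "exp (- K / 2) * (\<bar>a - b\<bar> / 2) \<le> \<bar>exp (a / 2) - exp (b / 2)\<bar>"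
    using *[of b a] *[of a b] assms by (cases "b \<le> a") (auto simp: abs_if)
  then have "(exp (- K / 2) * (\<bar>a - b\<bar> / 2))\<^sup>2 \<le> (exp (a / 2) - exp (b / 2))\<^sup>2"
    using power_mono[of "exp (- K / 2) * (\<bar>a - b\<bar> / 2)" "\<bar>exp (a / 2) - exp (b / 2)\<bar>" 2] by simp
  moreover have "(exp (- K / 2))\<^sup>2 = exp (- K)"
    by (simp add: exp_double[symmetric])
  then have "(exp (- K / 2) * (\<bar>a - b\<bar> / 2))\<^sup>2 = exp (- K) * (a - b)\<^sup>2 / 4"
    by (simp only: power_mult_distrib power_divide power2_abs) simp
  moreover have "(exp (a / 2) - exp (b / 2))\<^sup>2 = exp a + exp b - 2 * exp ((a + b) / 2)"
    by (simp add: power2_diff exp_double[symmetric] exp_add[symmetric] add_divide_distrib mult.assoc)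
  ultimately show ?thesis by argo
qed

lemma convergent_of_summable_diff:
  fixes f :: "nat \<Rightarrow> real"
  assumes "summable (\<lambda>n. f (Suc n) - f n)"
  shows "convergent f"
proof -
  obtain L where "(\<lambda>n. \<Sum>k<n. f (Suc k) - f k) \<longlonglongrightarrow> L"
    using summable_LIMSEQ[OF assms] by blast
  then have "(\<lambda>n. f n - f 0 + f 0) \<longlonglongrightarrow> L + f 0"
    by (intro tendsto_add) (simp_all add: sum_lessThan_telescope)
  then show ?thesis by (auto simp: convergent_def)
qed

text \<open>Weighted by \<open>2 ^ n\<close>, the squared increments still have integral at most
  \<open>(1 / 2) ^ n\<close>, so the weighted series is finite almost everywhere; this forces
  absolute summability of the increments.\<close>

lemma AE_convergent_of_L2_rate:
  fixes f :: "nat \<Rightarrow> 'a \<Rightarrow> real"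
  assumes [measurable]: "\<And>n. f n \<in> borel_measurable M"
    and rate: "\<And>n. (\<integral>\<^sup>+x. ennreal ((f (Suc n) x - f n x)\<^sup>2) \<partial>M) \<le> ennreal ((1 / 4) ^ n)"
  shows "AE x in M. convergent (\<lambda>n. f n x)"
proof -
  let ?h = "\<lambda>n x. 2 ^ n * (f (Suc n) x - f n x)\<^sup>2"
  have "(\<integral>\<^sup>+x. (\<Sum>n. ennreal (?h n x)) \<partial>M) = (\<Sum>n. \<integral>\<^sup>+x. ennreal (?h n x) \<partial>M)"
    by (intro nn_integral_suminf) measurable
  also have "\<dots> \<le> (\<Sum>n. ennreal ((1 / 2) ^ n))"
  proof (intro suminf_le summableI)
    fix n
    have "(\<integral>\<^sup>+x. ennreal (?h n x) \<partial>M) = ennreal (2 ^ n) * (\<integral>\<^sup>+x. ennreal ((f (Suc n) x - f n x)\<^sup>2) \<partial>M)"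
      by (subst nn_integral_cmult[symmetric]) (auto simp: ennreal_mult)
    also have "\<dots> \<le> ennreal (2 ^ n) * ennreal ((1 / 4) ^ n)"
      by (intro mult_left_mono rate) auto
    also have "\<dots> = ennreal ((1 / 2) ^ n)"
      by (simp add: ennreal_mult[symmetric] power_mult_distrib[symmetric])
    finally show "(\<integral>\<^sup>+x. ennreal (?h n x) \<partial>M) \<le> ennreal ((1 / 2) ^ n)" .
  qed
  also have "\<dots> < \<infinity>" by (subst suminf_ennreal2) (auto intro: summable_geometric)
  finally have "(\<integral>\<^sup>+x. (\<Sum>n. ennreal (?h n x)) \<partial>M) \<noteq> \<infinity>" by simp
  then have "AE x in M. (\<Sum>n. ennreal (?h n x)) \<noteq> \<infinity>"
    by (intro nn_integral_PInf_AE) measurable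
  then show ?thesis
  proof eventually_elim
    case (elim x)
    have "summable (\<lambda>n. ?h n x)"
      using elim by (intro summable_suminf_not_top) auto
    then have s: "summable (\<lambda>n. ?h n x + (1 / 2) ^ n)" by (intro summable_add summable_geometric) auto
    \<comment> \<open>Either the increment \<open>d\<close> is at most \<open>(1 / 2) ^ n\<close>,
      or \<open>2 ^ n * d > 1\<close> and then it is dominated by its weighted square.\<close>
    have "norm (f (Suc n) x - f n x) \<le> ?h n x + (1 / 2) ^ n" for n
    proof -
      define d where "d = \<bar>f (Suc n) x - f n x\<bar>"
      have d: "0 \<le> d" "(f (Suc n) x - f n x)\<^sup>2 = d * d" by (simp_all add: d_def power2_eq_square)
      show ?thesis
      proof (cases "d \<le> (1 / 2) ^ n")
        case True
        then show ?thesis using d by (simp add: d_def[symmetric] add_increasing)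
      next
        case False
        then have "1 \<le> 2 ^ n * d" by (simp add: field_simps)
        then have "d \<le> 2 ^ n * (d * d)" using d mult_right_mono[of 1 "2 ^ n * d" d] by (simp add: mult.assoc)
        then show ?thesis using d by (simp add: d_def[symmetric] add_increasing2)
      qed
    qed
    then have "summable (\<lambda>n. norm (f (Suc n) x - f n x))"
      by (intro summable_comparison_test'[OF s, of 0]) simp
    then show ?case by (rule convergent_of_summable_diff[OF summable_norm_cancel])
  qed
qed

context entropic_ot
begin

text \<open>Tonelli for a null set: for almost every choice of the other coordinates the section is
  good almost everywhere, and one such choice is kept.\<close>

lemma AE_section:
  assumes i: "i \<in> {1..N}" and Q: "AE x in prodM. Q x"
  obtains y where "y \<in> space (PiM ({1..N} - {i}) M)" "AE z in M i. Q (y(i := z))"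
proof -
  let ?J = "{1..N} - {i}"
  have ins: "insert i ?J = {1..N}" using i by auto
  interpret J: prob_space "PiM ?J M" by (rule prob_space_PiM) (rule prob_space_M)
  \<comment> \<open>\<open>Q\<close> need not define a measurable set, so a measurable null set
    covering its failures takes its place.\<close>
  obtain A where A: "A \<in> null_sets prodM" "{x \<in> space prodM. \<not> Q x} \<subseteq> A"
    using Q unfolding eventually_ae_filter by auto
  have [measurable]: "A \<in> sets prodM" using A by auto
  have [measurable]: "(\<lambda>z. y(i := z)) \<in> M i \<rightarrow>\<^sub>M prodM" if "y \<in> space (PiM ?J M)" for y
    using measurable_compose[OF measurable_Pair1'[OF that] measurable_insert[OF i]] by simp
  have "(\<integral>\<^sup>+y. (\<integral>\<^sup>+z. indicator A (y(i := z)) \<partial>M i) \<partial>PiM ?J M) = (\<integral>\<^sup>+x. indicator A x \<partial>prodM)"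
    using product_nn_integral_insert[of ?J i "indicator A"] ins by simp
  also have "\<dots> = 0" using A by (auto simp: null_setsD1)
  finally have "AE y in PiM ?J M. (\<integral>\<^sup>+z. indicator A (y(i := z)) \<partial>M i) = 0"
  proof (subst (asm) nn_integral_0_iff_AE)
    have [measurable]: "(\<lambda>x. (fst x)(i := snd x)) \<in> PiM ?J M \<Otimes>\<^sub>M M i \<rightarrow>\<^sub>M prodM"
      using measurable_insert[OF i] by (simp add: case_prod_unfold)
    show "(\<lambda>y. \<integral>\<^sup>+z. indicator A (y(i := z)) \<partial>M i) \<in> borel_measurable (PiM ?J M)"
      by (rule M.borel_measurable_nn_integral) (simp add: case_prod_unfold)
  qed
  then have "AE y in PiM ?J M. y \<in> space (PiM ?J M) \<and> (\<integral>\<^sup>+z. indicator A (y(i := z)) \<partial>M i) = 0"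
    using AE_space by eventually_elim auto
  then obtain y where y: "y \<in> space (PiM ?J M)" "(\<integral>\<^sup>+z. indicator A (y(i := z)) \<partial>M i) = 0"
    using eventually_happens'[OF J.ae_filter_bot] by blast
  have [measurable]: "(\<lambda>z. indicator A (y(i := z)) :: ennreal) \<in> borel_measurable (M i)"
    using y(1) by measurable
  have "AE z in M i. indicator A (y(i := z)) = (0 :: ennreal)"
    using y(2) by (subst (asm) nn_integral_0_iff_AE) auto
  then have "AE z in M i. Q (y(i := z))"
    using AE_space
  proof eventually_elim
    case (elim z)
    then show ?case using fun_upd_in_space[OF i y(1), of z] A(2) by (auto simp: indicator_def split: if_splits)
  qed
  with y(1) show thesis by (rule that)
qed

section \<open>Sums of potentials, bounded tuples and their energy\<close>

lemma osum_fun_upd: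
  assumes "i \<in> {1..N}"
  shows "osum r (y(i := z)) = r i z + (\<Sum>j\<in>{1..N} - {i}. r j (y j))"
  using assms unfolding osum_def by (subst sum.remove[of _ i]) (auto intro!: sum.cong)

text \<open>Formulated for any measure with the right marginal, so as to serve both the product
  measure and couplings.\<close>

lemma integral_component:
  assumes "sets \<gamma> = sets prodM" "distr \<gamma> (M i) (\<lambda>x. x i) = M i" "i \<in> {1..N}"
    and f: "integrable (M i) f"
  shows "integrable \<gamma> (\<lambda>x. f (x i))" "(\<integral>x. f (x i) \<partial>\<gamma>) = (\<integral>x. (f x :: real) \<partial>M i)"
proof -
  have [measurable]: "f \<in> borel_measurable (M i)" using f by auto
  have [measurable]: "(\<lambda>x. x i) \<in> \<gamma> \<rightarrow>\<^sub>M M i"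
    using measurable_component_singleton[OF assms(3), of M] assms(1)
    by (simp cong: measurable_cong_sets)
  show "integrable \<gamma> (\<lambda>x. f (x i))"
    using f assms(2) by (subst integrable_distr_eq[symmetric, where N = "M i"]) auto
  show "(\<integral>x. f (x i) \<partial>\<gamma>) = (\<integral>x. f x \<partial>M i)"
    using integral_distr[of "\<lambda>x. x i" \<gamma> "M i" f] assms(2) by simp
qed

lemma integral_osum:
  assumes "sets \<gamma> = sets prodM" "\<And>i. i \<in> {1..N} \<Longrightarrow> distr \<gamma> (M i) (\<lambda>x. x i) = M i"
    and "\<And>i. i \<in> {1..N} \<Longrightarrow> integrable (M i) (r i)"
  shows "integrable \<gamma> (osum r)" "(\<integral>x. osum r x \<partial>\<gamma>) = (\<Sum>i\<in>{1..N}. \<integral>x. r i x \<partial>M i)"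
  unfolding osum_def[abs_def] using integral_component[OF assms(1)] assms(2,3)
  by (auto intro!: Bochner_Integration.integrable_sum simp: Bochner_Integration.integral_sum)

text \<open>The bounds hold everywhere on the space, not just almost everywhere. Transforms have
  this property, and it gives pointwise estimates on every section.\<close>

definition bounded_tuple :: "(nat \<Rightarrow> 'a \<Rightarrow> real) \<Rightarrow> bool" where
  "bounded_tuple r \<longleftrightarrow> (\<forall>i\<in>{1..N}. r i \<in> borel_measurable (M i) \<and> (\<exists>R. \<forall>x\<in>space (M i). \<bar>r i x\<bar> \<le> R))"

text \<open>The dual functional as a function of the sum of the potentials alone, so that concavity
  can be exploited without splitting \<open>f\<close> into summands.\<close>

definition energy :: "((nat \<Rightarrow> 'a) \<Rightarrow> real) \<Rightarrow> real" where
  "energy f = (\<integral>x. f x - e * exp ((f x - c x) / e) \<partial>prodM)"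

lemma bounded_tuple_measurable:
  "bounded_tuple r \<Longrightarrow> i \<in> {1..N} \<Longrightarrow> r i \<in> borel_measurable (M i)"
  by (auto simp: bounded_tuple_def)

lemma bounded_tuple_integrable:
  assumes "bounded_tuple r" "i \<in> {1..N}"
  shows "integrable (M i) (r i)"
proof -
  obtain R where "\<And>x. x \<in> space (M i) \<Longrightarrow> \<bar>r i x\<bar> \<le> R" and [measurable]: "r i \<in> borel_measurable (M i)"
    using assms unfolding bounded_tuple_def by blast
  then show ?thesis by (intro M.integrable_const_bound[where B = R]) auto
qed

lemma space_prodM_component: "x \<in> space prodM \<Longrightarrow> i \<in> {1..N} \<Longrightarrow> x i \<in> space (M i)"
  by (auto simp: space_PiM PiE_iff)

lemma exp_arg_bounds:
  assumes "x \<in> space prodM" "\<bar>s\<bar> \<le> R"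
  shows "\<bar>(s - c x) / e\<bar> \<le> (R + B) / e"
  using c_bounded[OF assms(1)] assms(2) e_pos by (auto simp: abs_divide intro!: divide_right_mono)

lemma integrable_energy:
  assumes [measurable]: "f \<in> borel_measurable prodM" and b: "\<And>x. x \<in> space prodM \<Longrightarrow> \<bar>f x\<bar> \<le> R"
  shows "integrable prodM f" "integrable prodM (\<lambda>x. exp ((f x - c x) / e))"
proof -
  show "integrable prodM f"
    using b by (intro P.integrable_const_bound[where B = R]) auto
  have "exp ((f x - c x) / e) \<le> exp ((R + B) / e)" if "x \<in> space prodM" for x
    using exp_arg_bounds[OF that b[OF that]] by (simp only: exp_le_cancel_iff abs_le_iff)
  then show "integrable prodM (\<lambda>x. exp ((f x - c x) / e))"
    by (intro P.integrable_const_bound[where B = "exp ((R + B) / e)"]) auto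
qed

lemma bounded_tuple_dual_dom:
  assumes "bounded_tuple r"
  shows "(\<lambda>i x. ereal (r i x)) \<in> dual_dom N e M"
proof -
  have "(\<lambda>x. ereal (r i x)) \<in> Lexp e (M i)" if i: "i \<in> {1..N}" for i
  proof -
    obtain R where "\<And>x. x \<in> space (M i) \<Longrightarrow> \<bar>r i x\<bar> \<le> R"
      using assms i unfolding bounded_tuple_def by metis
    then show ?thesis by (intro bounded_in_Lexp bounded_tuple_measurable[OF assms i])
  qed
  then show ?thesis by (simp add: dual_dom_def)
qed

lemma dual_bounded_tuple:
  assumes r: "bounded_tuple r"
  shows "dual N e c M (\<lambda>i x. ereal (r i x)) = ereal (energy (osum r))"
    and "integrable prodM (osum r)" "integrable prodM (gibbs_real r)"
proof -
  let ?u = "\<lambda>i x. ereal (r i x)"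
  note u = bounded_tuple_dual_dom[OF r]
  note int = bounded_tuple_integrable[OF r]
  have fin: "dual N e c M ?u \<noteq> -\<infinity>"
    unfolding dual_eq_MInf_iff[OF u] using ext_integral_real[OF int] by auto
  note osum = integral_osum[OF refl PiM_component int]
  show i1: "integrable prodM (osum r)" by (rule osum(1))
  show i2: "integrable prodM (gibbs_real r)" using dual_finite(4)[OF u fin] by simp
  show "dual N e c M ?u = ereal (energy (osum r))"
    using dual_finite(5)[OF u fin] i1 i2 osum(2)
    by (simp add: energy_def gibbs_real_def[abs_def])
qed

text \<open>The tangent of the exponential at \<open>0\<close> gives
  \<open>s - e * exp ((s - c) / e) \<le> c - e\<close> pointwise. Hence the supremum over bounded
  tuples is finite.\<close>

lemma energy_le:
  assumes r: "bounded_tuple r"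
  shows "energy (osum r) \<le> B - e"
proof -
  have "energy (osum r) \<le> (\<integral>x. B - e \<partial>prodM)"
    unfolding energy_def
  proof (rule integral_mono)
    show "integrable prodM (\<lambda>x. osum r x - e * exp ((osum r x - c x) / e))"
      using dual_bounded_tuple(2,3)[OF r] by (simp add: gibbs_real_def[abs_def])
    fix x assume x: "x \<in> space prodM"
    have "e * (1 + (osum r x - c x) / e) \<le> e * exp ((osum r x - c x) / e)"
      using e_pos by (intro mult_left_mono exp_ge_add_one_self) auto
    moreover have "e * (1 + (osum r x - c x) / e) = e + osum r x - c x"
      using e_pos by (simp add: field_simps)
    ultimately show "osum r x - e * exp ((osum r x - c x) / e) \<le> B - e"
      using c_bounded[OF x] by linarith
  qed simp
  then show ?thesis by (simp add: P.prob_space)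
qed

text \<open>Induction on the set of coordinates already transformed. Transforming one more does not
  lower the energy, leaves the oscillation bounds of the earlier ones intact and sets the total mass
  to \<open>1\<close>, so the mass condition holds from the first replacement on.\<close>

lemma bounded_tuple_improve:
  assumes r: "bounded_tuple r" and J: "finite J" "J \<subseteq> {1..N}"
  shows "\<exists>s. bounded_tuple s \<and> energy (osum r) \<le> energy (osum s) \<and>
    (\<forall>j\<in>J. \<exists>a. \<forall>x\<in>space (M j). \<bar>s j x - a\<bar> \<le> B) \<and>
    (J \<noteq> {} \<longrightarrow> (\<integral>x. gibbs_real s x \<partial>prodM) = 1)"
  using J
proof (induction J)
  case empty
  then show ?case using r by auto
next
  case (insert i J)
  then obtain s where s: "bounded_tuple s" "energy (osum r) \<le> energy (osum s)"
    "\<And>j. j \<in> J \<Longrightarrow> \<exists>a. \<forall>x\<in>space (M j). \<bar>s j x - a\<bar> \<le> B" by auto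
  have i: "i \<in> {1..N}" using insert by auto
  let ?u = "\<lambda>i x. ereal (s i x)"
  note u = bounded_tuple_dual_dom[OF s(1)]
  define h where "h = transform i ?u"
  define s' where "s' = s(i := h)"
  have h: "\<bar>h x - (- e * ln (mass_others i ?u))\<bar> \<le> B" if "x \<in> space (M i)" for x
    using partial_mass_transform(2)[OF i u that] by (simp add: h_def)
  have s': "bounded_tuple s'"
    unfolding bounded_tuple_def
  proof (intro ballI conjI)
    fix j assume j: "j \<in> {1..N}"
    show "s' j \<in> borel_measurable (M j)"
      using transform_measurable[OF i u] bounded_tuple_measurable[OF s(1) j] by (auto simp: s'_def h_def)
    show "\<exists>R. \<forall>x\<in>space (M j). \<bar>s' j x\<bar> \<le> R"
      using transform_bounded[OF i u] s(1) j unfolding s'_def h_def bounded_tuple_def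
      by (cases "j = i") auto
  qed
  have u': "(\<lambda>j x. ereal (s' j x)) = ?u(i := \<lambda>x. ereal (h x))" by (auto simp: s'_def)
  have "energy (osum s) \<le> energy (osum s')"
    using dual_le_dual_transform[OF i u] dual_bounded_tuple(1)[OF s(1)] dual_bounded_tuple(1)[OF s']
    unfolding u' h_def by simp
  moreover have "\<exists>a. \<forall>x\<in>space (M j). \<bar>s' j x - a\<bar> \<le> B" if "j \<in> insert i J" for j
    using h s(3) that unfolding s'_def by (cases "j = i") (auto intro!: exI[of _ "- e * ln (mass_others i ?u)"])
  moreover have "(\<integral>x. gibbs_real s' x \<partial>prodM) = 1"
  proof -
    have "(\<integral>\<^sup>+x. ennreal (gibbs_real s' x) \<partial>prodM)
        = (\<integral>\<^sup>+x. gibbs N e c (?u(i := \<lambda>x. ereal (h x))) x \<partial>prodM)"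
      by (simp add: gibbs_ereal flip: u')
    also have "\<dots> = (\<integral>\<^sup>+x. exp_ext ((ereal (h x) - ereal (transform i ?u x)) / ereal e) \<partial>M i)"
      unfolding h_def by (intro transform_mass[OF i u] transform_in_Lexp[OF i u])
    also have "\<dots> = 1" by (simp add: h_def M.emeasure_space_1 exp_ext_def)
    finally have "(\<integral>\<^sup>+x. ennreal (gibbs_real s' x) \<partial>prodM) = 1" .
    then show ?thesis
      using dual_bounded_tuple(3)[OF s'] by (subst integral_eq_nn_integral) (auto simp: gibbs_real_def)
  qed
  ultimately show ?case using s(2) s' by (intro exI[of _ s']) auto
qed

text \<open>Each transformed potential is within \<open>B\<close> of a constant, so only the sum
  \<open>A\<close> of these constants remains to be controlled. Unit mass does this: if
  \<open>\<bar>A\<bar>\<close> exceeded \<open>(N + 1) * B\<close>, the Gibbs exponent would have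
  one strict sign throughout. Adding the oscillation \<open>N * B\<close> yields the factor
  \<open>2 * N + 1\<close>.\<close>

lemma bounded_tuple_uniform_improve:
  assumes r: "bounded_tuple r"
  obtains s where "bounded_tuple s" "energy (osum r) \<le> energy (osum s)"
    "\<And>x. x \<in> space prodM \<Longrightarrow> \<bar>osum s x\<bar> \<le> (2 * real N + 1) * B"
proof -
  obtain s where s: "bounded_tuple s" "energy (osum r) \<le> energy (osum s)"
    "\<And>j. j \<in> {1..N} \<Longrightarrow> \<exists>a. \<forall>x\<in>space (M j). \<bar>s j x - a\<bar> \<le> B"
    "(\<integral>x. gibbs_real s x \<partial>prodM) = 1"
    using bounded_tuple_improve[OF r, of "{1..N}"] N_pos by auto
  then obtain a where a: "\<And>j x. j \<in> {1..N} \<Longrightarrow> x \<in> space (M j) \<Longrightarrow> \<bar>s j x - a j\<bar> \<le> B"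
    by metis
  define A where "A = (\<Sum>j\<in>{1..N}. a j)"
  have A: "\<bar>osum s x - A\<bar> \<le> real N * B" if "x \<in> space prodM" for x
  proof -
    have "\<bar>osum s x - A\<bar> = \<bar>\<Sum>j\<in>{1..N}. s j (x j) - a j\<bar>"
      by (simp add: osum_def A_def sum_subtractf)
    also have "\<dots> \<le> (\<Sum>j\<in>{1..N}. B)"
      by (rule order_trans[OF sum_abs]) (intro sum_mono a space_prodM_component that)
    finally show ?thesis by simp
  qed
  note int = dual_bounded_tuple(3)[OF s(1)]
  have "\<bar>A\<bar> \<le> (real N + 1) * B"
  proof (rule ccontr)
    assume neg: "\<not> ?thesis"
    show False
    proof (cases "A > 0")
      case True
      \<comment> \<open>A positive lower bound of the exponent: \<open>N * B\<close> is lost to the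
        oscillation of the potentials, one more \<open>B\<close> to the cost.\<close>
      define d where "d = (A - (real N + 1) * B) / e"
      have d: "d > 0" using neg True e_pos by (simp add: d_def)
      have "(\<integral>x. exp d \<partial>prodM) \<le> (\<integral>x. gibbs_real s x \<partial>prodM)"
      proof (rule integral_mono)
        fix x assume x: "x \<in> space prodM"
        show "exp d \<le> gibbs_real s x"
          unfolding gibbs_real_def d_def using A[OF x] c_bounded[OF x] e_pos
          by (auto intro!: divide_right_mono simp: algebra_simps)
      qed (use int in auto)
      then show False using d s(4) by (simp add: P.prob_space)
    next
      case False
      define d where "d = (A + (real N + 1) * B) / e"
      have d: "d < 0" using neg False e_pos by (auto simp: d_def divide_less_0_iff)
      have "(\<integral>x. gibbs_real s x \<partial>prodM) \<le> (\<integral>x. exp d \<partial>prodM)"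
      proof (rule integral_mono)
        fix x assume x: "x \<in> space prodM"
        show "gibbs_real s x \<le> exp d"
          unfolding gibbs_real_def d_def using A[OF x] c_bounded[OF x] e_pos
          by (auto intro!: divide_right_mono simp: algebra_simps)
      qed (use int in auto)
      then show False using d s(4) by (simp add: P.prob_space)
    qed
  qed
  then have "\<bar>osum s x\<bar> \<le> (2 * real N + 1) * B" if "x \<in> space prodM" for x
    using A[OF that] by (simp add: algebra_simps)
  with s(1,2) show thesis by (rule that)
qed

end

section \<open>Existence of an optimal tuple\<close>

context entropic_ot
begin

text \<open>The linear term is exact at midpoints; the exponential contributes its strong convexity
  with \<open>K = (R + B) / e\<close>. Two factors \<open>1 / e\<close> from \<open>p - q\<close>
  and one factor \<open>e\<close> in front combine to \<open>exp (- K) / (8 * e)\<close>.\<close>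

lemma energy_midpoint:
  assumes [measurable]: "f \<in> borel_measurable prodM" "g \<in> borel_measurable prodM"
    and b: "\<And>x. x \<in> space prodM \<Longrightarrow> \<bar>f x\<bar> \<le> R" "\<And>x. x \<in> space prodM \<Longrightarrow> \<bar>g x\<bar> \<le> R"
  shows "(energy f + energy g) / 2 + exp (- ((R + B) / e)) / (8 * e) * (\<integral>x. (f x - g x)\<^sup>2 \<partial>prodM)
    \<le> energy (\<lambda>x. (f x + g x) / 2)"
    and "integrable prodM (\<lambda>x. (f x - g x)\<^sup>2)"
proof -
  define k where "k = exp (- ((R + B) / e)) / (8 * e)"
  note f = integrable_energy[OF assms(1) b(1)] and g = integrable_energy[OF assms(2) b(2)]
  have bm: "\<bar>(f x + g x) / 2\<bar> \<le> R" if "x \<in> space prodM" for x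
    using b[OF that] by auto
  note m = integrable_energy[of "\<lambda>x. (f x + g x) / 2", OF _ bm, simplified]
  show sq: "integrable prodM (\<lambda>x. (f x - g x)\<^sup>2)"
  proof (rule P.integrable_const_bound)
    have "norm ((f x - g x)\<^sup>2) \<le> (2 * R)\<^sup>2" if "x \<in> space prodM" for x
      using b[OF that] power_mono[of "\<bar>f x - g x\<bar>" "2 * R" 2] by auto
    then show "AE x in prodM. norm ((f x - g x)\<^sup>2) \<le> (2 * R)\<^sup>2" by auto
  qed simp
  let ?F = "\<lambda>h x. h x - e * exp ((h x - c x) / e)"
  have iF: "integrable prodM (?F f)" and iG: "integrable prodM (?F g)" using f g by simp_all
  have "(energy f + energy g) / 2 + k * (\<integral>x. (f x - g x)\<^sup>2 \<partial>prodM)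
      = (\<integral>x. (?F f x + ?F g x) / 2 + k * (f x - g x)\<^sup>2 \<partial>prodM)"
    unfolding energy_def using sq by (subst Bochner_Integration.integral_add[OF iF iG, symmetric])
      (simp add: iF iG)
  also have "\<dots> \<le> energy (\<lambda>x. (f x + g x) / 2)"
    unfolding energy_def
  proof (rule integral_mono)
    show "integrable prodM (\<lambda>x. (?F f x + ?F g x) / 2 + k * (f x - g x)\<^sup>2)" using iF iG sq by simp
    show "integrable prodM (\<lambda>x. (f x + g x) / 2 - e * exp (((f x + g x) / 2 - c x) / e))"
      using m by simp
    fix x assume x: "x \<in> space prodM"
    define p q where "p = (f x - c x) / e" and "q = (g x - c x) / e"
    have "\<bar>p\<bar> \<le> (R + B) / e" "\<bar>q\<bar> \<le> (R + B) / e"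
      unfolding p_def q_def using b[OF x] exp_arg_bounds[OF x] by blast+
    then have "e * (exp ((p + q) / 2) + exp (- ((R + B) / e)) * (p - q)\<^sup>2 / 8) \<le> e * ((exp p + exp q) / 2)"
      using e_pos by (intro mult_left_mono exp_midpoint_strong_convex) auto
    moreover have "((f x + g x) / 2 - c x) / e = (p + q) / 2"
      using e_pos by (simp add: p_def q_def field_simps)
    moreover have "e * (exp (- ((R + B) / e)) * (p - q)\<^sup>2 / 8) = k * (f x - g x)\<^sup>2"
    proof -
      have "p - q = (f x - g x) / e" by (simp add: p_def q_def diff_divide_distrib)
      then show ?thesis using e_pos by (simp add: k_def power_divide power2_eq_square)
    qed
    ultimately show "(?F f x + ?F g x) / 2 + k * (f x - g x)\<^sup>2
        \<le> (f x + g x) / 2 - e * exp (((f x + g x) / 2 - c x) / e)"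
      unfolding p_def[symmetric] q_def[symmetric] by (simp only: distrib_left) argo
  qed
  finally show "(energy f + energy g) / 2 + exp (- ((R + B) / e)) / (8 * e) * (\<integral>x. (f x - g x)\<^sup>2 \<partial>prodM)
    \<le> energy (\<lambda>x. (f x + g x) / 2)"
    by (simp add: k_def)
qed

text \<open>The single potentials may drift by constants that cancel in the sum. Each is therefore
  normalised along a section of its own, and the accumulated correction is removed after the passage
  to the limit.\<close>

lemma osum_limit:
  assumes U: "\<And>n. bounded_tuple (U n)"
    and b: "\<And>n x. x \<in> space prodM \<Longrightarrow> \<bar>osum (U n) x\<bar> \<le> R"
    and conv: "AE x in prodM. convergent (\<lambda>n. osum (U n) x)"
  obtains w where "bounded_tuple w" "AE x in prodM. (\<lambda>n. osum (U n) x) \<longlonglongrightarrow> osum w x"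
proof -
  have "\<exists>y. y \<in> space (PiM ({1..N} - {i}) M) \<and> (AE z in M i. convergent (\<lambda>n. osum (U n) (y(i := z))))"
    if "i \<in> {1..N}" for i
    using AE_section[OF that conv] by blast
  then obtain y where y: "\<And>i. i \<in> {1..N} \<Longrightarrow> y i \<in> space (PiM ({1..N} - {i}) M)"
    "\<And>i. i \<in> {1..N} \<Longrightarrow> AE z in M i. convergent (\<lambda>n. osum (U n) ((y i)(i := z)))"
    by metis
  define a where "a n i = (\<Sum>j\<in>{1..N} - {i}. U n j (y i j))" for n i
  \<comment> \<open>Along the section through \<open>y i\<close> the sum differs from its \<open>i\<close>-th summand by a constant
    depending on \<open>n\<close> only; the clamping keeps the limit bounded off the convergence set.\<close>
  define w0 where "w0 i z = max (- R) (min R (Topological_Spaces.lim (\<lambda>n. U n i z + a n i)))" for i z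
  have lim: "AE z in M i. (\<lambda>n. U n i z + a n i) \<longlonglongrightarrow> w0 i z" if i: "i \<in> {1..N}" for i
    using y(2)[OF i] AE_space
  proof eventually_elim
    case (elim z)
    have o: "osum (U n) ((y i)(i := z)) = U n i z + a n i" for n
      unfolding osum_fun_upd[OF i] a_def ..
    have l: "(\<lambda>n. U n i z + a n i) \<longlonglongrightarrow> Topological_Spaces.lim (\<lambda>n. U n i z + a n i)"
      using elim(1) unfolding o convergent_LIMSEQ_iff .
    have bd: "- R \<le> U n i z + a n i" "U n i z + a n i \<le> R" for n
      using b[OF fun_upd_in_space[OF i y(1)[OF i] elim(2)], of n] unfolding o by linarith+
    have "- R \<le> Topological_Spaces.lim (\<lambda>n. U n i z + a n i)"
      by (rule LIMSEQ_le_const[OF l]) (use bd in simp)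
    moreover have "Topological_Spaces.lim (\<lambda>n. U n i z + a n i) \<le> R"
      by (rule LIMSEQ_le_const2[OF l]) (use bd in simp)
    ultimately have "w0 i z = Topological_Spaces.lim (\<lambda>n. U n i z + a n i)" unfolding w0_def by simp
    then show ?case using l by simp
  qed
  have w0_meas: "w0 i \<in> borel_measurable (M i)" if "i \<in> {1..N}" for i
  proof -
    have [measurable]: "U n i \<in> borel_measurable (M i)" for n
      using U that by (intro bounded_tuple_measurable)
    show ?thesis unfolding w0_def[abs_def] by measurable
  qed
  have w0_b: "\<bar>w0 i z\<bar> \<le> \<bar>R\<bar>" for i z unfolding w0_def by auto
  define A where "A n = (\<Sum>i\<in>{1..N}. a n i)" for n
  have "AE x in prodM. \<forall>i\<in>{1..N}. (\<lambda>n. U n i (x i) + a n i) \<longlonglongrightarrow> w0 i (x i)"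
    by (intro eventually_ball_finite ballI AE_component lim) auto
  then have limA: "AE x in prodM. (\<lambda>n. osum (U n) x + A n) \<longlonglongrightarrow> osum w0 x"
  proof eventually_elim
    case (elim x)
    then have "(\<lambda>n. \<Sum>i\<in>{1..N}. U n i (x i) + a n i) \<longlonglongrightarrow> (\<Sum>i\<in>{1..N}. w0 i (x i))"
      by (intro tendsto_sum) auto
    then show ?case by (simp add: osum_def A_def sum.distrib)
  qed
  \<comment> \<open>The constants \<open>A n\<close> do not depend on the point, so a single point
    at which both sequences converge determines their limit.\<close>
  have "\<exists>x. (\<lambda>n. osum (U n) x + A n) \<longlonglongrightarrow> osum w0 x \<and> convergent (\<lambda>n. osum (U n) x)"
    using eventually_happens'[OF P.ae_filter_bot eventually_conj[OF limA conv]] by blast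
  then obtain x0 L where x0: "(\<lambda>n. osum (U n) x0 + A n) \<longlonglongrightarrow> osum w0 x0" "(\<lambda>n. osum (U n) x0) \<longlonglongrightarrow> L"
    by (auto simp: convergent_def)
  define \<alpha> where "\<alpha> = osum w0 x0 - L"
  have A: "A \<longlonglongrightarrow> \<alpha>" using tendsto_diff[OF x0] unfolding \<alpha>_def by simp
  \<comment> \<open>The surplus constant is charged to one coordinate, which exists because
    \<open>N \<ge> 1\<close>.\<close>
  define w where "w = w0(1 := \<lambda>z. w0 1 z - \<alpha>)"
  have one: "1 \<in> {1..N}" using N_pos by simp
  have w: "osum w x = osum w0 x - \<alpha>" for x
  proof -
    have "(\<Sum>j\<in>{1..N} - {1}. w j (x j)) = (\<Sum>j\<in>{1..N} - {1}. w0 j (x j))"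
      by (intro sum.cong) (auto simp: w_def)
    then show ?thesis
      using one by (simp add: osum_def sum.remove[of "{1..N}" 1] w_def)
  qed
  have "bounded_tuple w"
    unfolding bounded_tuple_def
  proof (intro ballI conjI)
    fix i assume i: "i \<in> {1..N}"
    show "w i \<in> borel_measurable (M i)" using w0_meas[OF i] by (auto simp: w_def)
    have "\<bar>w i z\<bar> \<le> \<bar>R\<bar> + \<bar>\<alpha>\<bar>" for z
      using w0_b[of i z] by (cases "i = 1") (auto simp: w_def)
    then show "\<exists>R. \<forall>z\<in>space (M i). \<bar>w i z\<bar> \<le> R" by blast
  qed
  moreover have "AE x in prodM. (\<lambda>n. osum (U n) x) \<longlonglongrightarrow> osum w x"
    using limA
  proof eventually_elim
    case (elim x)
    then show ?case using tendsto_diff[OF elim A] by (simp add: w)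
  qed
  ultimately show thesis by (rule that)
qed

lemma exists_bounded_maximizer:
  obtains w where "bounded_tuple w" "\<And>u. bounded_tuple u \<Longrightarrow> energy (osum u) \<le> energy (osum w)"
proof -
  define R where "R = (2 * real N + 1) * B"
  define k where "k = exp (- ((R + B) / e)) / (8 * e)"
  have k: "k > 0" using e_pos by (simp add: k_def)
  define S where "S = {energy (osum u) | u. bounded_tuple u}"
  define s where "s = Sup S"
  have bdd: "bdd_above S" using energy_le by (auto simp: S_def intro!: bdd_aboveI[of _ "B - e"])
  have "bounded_tuple (\<lambda>_ _. 0)" by (auto simp: bounded_tuple_def)
  then have ne: "S \<noteq> {}" by (auto simp: S_def)
  have le_s: "energy (osum u) \<le> s" if "bounded_tuple u" for u
    unfolding s_def using that bdd by (intro cSup_upper) (auto simp: S_def)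
  \<comment> \<open>Here \<open>k\<close> is the modulus of concavity in the midpoint inequality, so
    a tolerance of \<open>k / 4 ^ n\<close> leaves exactly the rate \<open>(1 / 4) ^ n\<close> after
    division by \<open>k\<close>. The uniform bound on the sum costs no energy.\<close>
  have "\<exists>u. bounded_tuple u \<and> s - k / 4 ^ n < energy (osum u) \<and> (\<forall>x\<in>space prodM. \<bar>osum u x\<bar> \<le> R)" for n
  proof -
    have "s - k / 4 ^ n < s" using k by simp
    then obtain u where "bounded_tuple u" "s - k / 4 ^ n < energy (osum u)"
      unfolding s_def less_cSup_iff[OF ne bdd] by (auto simp: S_def)
    then show ?thesis
      unfolding R_def by (meson bounded_tuple_uniform_improve less_le_trans)
  qed
  then obtain U where U: "\<And>n. bounded_tuple (U n)" "\<And>n. s - k / 4 ^ n < energy (osum (U n))"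
    "\<And>n x. x \<in> space prodM \<Longrightarrow> \<bar>osum (U n) x\<bar> \<le> R"
    by metis
  have meas [measurable]: "osum (U n) \<in> borel_measurable prodM" for n
    by (intro osum_measurable bounded_tuple_measurable U)
  have conv: "AE x in prodM. convergent (\<lambda>n. osum (U n) x)"
  proof (rule AE_convergent_of_L2_rate)
    fix n
    let ?f = "osum (U (Suc n))" and ?g = "osum (U n)"
    \<comment> \<open>The midpoint tuple is admissible and its sum is the midpoint of the two sums.
      Its energy thus stays below \<open>s\<close>, and the midpoint inequality limits the squared
      distance of two near-maximizers.\<close>
    define m where "m = (\<lambda>i x. (U (Suc n) i x + U n i x) / 2)"
    have "bounded_tuple m"
      unfolding bounded_tuple_def
    proof (intro ballI conjI)
      fix i assume i: "i \<in> {1..N}"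
      have [measurable]: "U n i \<in> borel_measurable (M i)" for n using U(1) i by (rule bounded_tuple_measurable)
      show "m i \<in> borel_measurable (M i)" unfolding m_def by measurable
      obtain R1 R2 where "\<And>x. x \<in> space (M i) \<Longrightarrow> \<bar>U (Suc n) i x\<bar> \<le> R1" "\<And>x. x \<in> space (M i) \<Longrightarrow> \<bar>U n i x\<bar> \<le> R2"
        using U(1)[of n] U(1)[of "Suc n"] i unfolding bounded_tuple_def by metis
      then have "\<forall>x\<in>space (M i). \<bar>m i x\<bar> \<le> (R1 + R2) / 2" unfolding m_def by fastforce
      then show "\<exists>R. \<forall>x\<in>space (M i). \<bar>m i x\<bar> \<le> R" by blast
    qed
    then have "energy (osum m) \<le> s" by (rule le_s)
    moreover have "osum m = (\<lambda>x. (?f x + ?g x) / 2)"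
      by (auto simp: osum_def m_def sum.distrib sum_divide_distrib[symmetric])
    ultimately have "(energy ?f + energy ?g) / 2 + k * (\<integral>x. (?f x - ?g x)\<^sup>2 \<partial>prodM) \<le> s"
      using energy_midpoint(1)[OF meas meas U(3) U(3), of "Suc n" n] unfolding k_def by simp
    moreover have "s - k / 4 ^ n \<le> energy ?f"
    proof -
      have "k / 4 ^ Suc n \<le> k / 4 ^ n" using k by (intro divide_left_mono) auto
      then show ?thesis using U(2)[of "Suc n"] by linarith
    qed
    ultimately have "k * (\<integral>x. (?f x - ?g x)\<^sup>2 \<partial>prodM) \<le> k / 4 ^ n"
      using U(2)[of n] by argo
    then have "(\<integral>x. (?f x - ?g x)\<^sup>2 \<partial>prodM) \<le> (1 / 4) ^ n"
      using k by (simp add: field_simps power_divide)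
    then show "(\<integral>\<^sup>+x. ennreal ((?f x - ?g x)\<^sup>2) \<partial>prodM) \<le> ennreal ((1 / 4) ^ n)"
      using energy_midpoint(2)[OF meas meas U(3) U(3), of "Suc n" n]
      by (subst nn_integral_eq_integral) (auto intro!: ennreal_leI)
  qed simp
  obtain w where w: "bounded_tuple w" and lim: "AE x in prodM. (\<lambda>n. osum (U n) x) \<longlonglongrightarrow> osum w x"
    using osum_limit[OF U(1) U(3) conv] by blast
  have [measurable]: "osum w \<in> borel_measurable prodM"
    by (intro osum_measurable bounded_tuple_measurable w)
  \<comment> \<open>Uniformly bounded sums have uniformly bounded integrands, so dominated
    convergence with a constant majorant shows that the limit attains the supremum.\<close>
  have "(\<lambda>n. energy (osum (U n))) \<longlonglongrightarrow> energy (osum w)"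
    unfolding energy_def
  proof (rule integral_dominated_convergence[where w = "\<lambda>_. R + e * exp ((R + B) / e)"])
    show "AE x in prodM. (\<lambda>n. osum (U n) x - e * exp ((osum (U n) x - c x) / e))
        \<longlonglongrightarrow> osum w x - e * exp ((osum w x - c x) / e)"
      using lim
    proof eventually_elim
      case (elim x)
      show ?case using e_pos by (intro tendsto_intros elim) auto
    qed
    show "AE x in prodM. norm (osum (U n) x - e * exp ((osum (U n) x - c x) / e)) \<le> R + e * exp ((R + B) / e)" for n
    proof (rule AE_I2)
      fix x assume x: "x \<in> space prodM"
      have "exp ((osum (U n) x - c x) / e) \<le> exp ((R + B) / e)"
        using exp_arg_bounds[OF x U(3)[OF x]] by (simp only: exp_le_cancel_iff abs_le_iff)
      then have "e * exp ((osum (U n) x - c x) / e) \<le> e * exp ((R + B) / e)"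
        using e_pos by simp
      moreover have "0 \<le> e * exp ((osum (U n) x - c x) / e)" using e_pos by simp
      ultimately show "norm (osum (U n) x - e * exp ((osum (U n) x - c x) / e)) \<le> R + e * exp ((R + B) / e)"
        using U(3)[OF x, of n] by (simp only: real_norm_def abs_le_iff) linarith
    qed
  qed simp_all
  moreover have "(\<lambda>n. s - k / 4 ^ n) \<longlonglongrightarrow> s - k * 0"
  proof -
    have "(\<lambda>n. s - k * (1 / 4) ^ n) \<longlonglongrightarrow> s - k * 0"
      by (intro tendsto_intros LIMSEQ_power_zero) simp
    then show ?thesis by (simp add: power_divide)
  qed
  ultimately have "s \<le> energy (osum w)"
    using U(2) by (intro LIMSEQ_le[of "\<lambda>n. s - k / 4 ^ n" s "\<lambda>n. energy (osum (U n))"]) (auto intro: less_imp_le)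
  then have "energy (osum u) \<le> energy (osum w)" if "bounded_tuple u" for u
    using le_s[OF that] by linarith
  with w show thesis by (rule that)
qed

end

section \<open>Weak duality and couplings\<close>

text \<open>Young's inequality for entropy and exponential: for \<open>g > 0\<close> the defect is
  \<open>g\<close> times \<open>exp s - 1 - s\<close> at \<open>s = p - ln g\<close>. At
  \<open>g = 0\<close> the entropy term vanishes and the defect is \<open>exp p > 0\<close>, so a
  zero defect rules this case out.\<close>

lemma fenchel_identity:
  fixes g p a :: real
  assumes "0 \<le> g"
  shows "g = 0 \<Longrightarrow> g * ln (g / exp (- a)) - g * (p + a) + exp p - g = exp p"
    and "g > 0 \<Longrightarrow> g * ln (g / exp (- a)) - g * (p + a) + exp p - g = g * (exp (p - ln g) - 1 - (p - ln g))"
    and "0 \<le> g * ln (g / exp (- a)) - g * (p + a) + exp p - g"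
    and "g * ln (g / exp (- a)) - g * (p + a) + exp p - g = 0 \<Longrightarrow> g = exp p"
proof -
  let ?d = "g * ln (g / exp (- a)) - g * (p + a) + exp p - g"
  show 1: "g = 0 \<Longrightarrow> ?d = exp p" by simp
  show 2: "?d = g * (exp (p - ln g) - 1 - (p - ln g))" if "g > 0"
    using that by (simp add: ln_div exp_diff algebra_simps)
  show "0 \<le> ?d"
  proof (cases "g = 0")
    case False
    then have "g > 0" using assms by simp
    then show ?thesis unfolding 2[OF \<open>g > 0\<close>] by (intro mult_nonneg_nonneg exp_diff_linear_nonneg) simp
  qed simp
  show "g = exp p" if "?d = 0"
  proof (cases "g = 0")
    case True
    then show ?thesis using that 1 by simp
  next
    case False
    then have g: "g > 0" using assms by simp
    then have "exp (p - ln g) - 1 - (p - ln g) = 0" using that 2 by simp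
    then have "p = ln g" unfolding exp_diff_linear_eq_0_iff by simp
    then show ?thesis using g by simp
  qed
qed

context entropic_ot
begin

section \<open>First variation at a maximizer\<close>

lemma maximizer_marginal:
  assumes w: "bounded_tuple w" and max: "\<And>u. bounded_tuple u \<Longrightarrow> energy (osum u) \<le> energy (osum w)"
    and i: "i \<in> {1..N}" and A [measurable]: "A \<in> sets (M i)"
  shows "integrable prodM (\<lambda>x. gibbs_real w x * indicator A (x i))"
    and "(\<integral>x. gibbs_real w x * indicator A (x i) \<partial>prodM) = measure (M i) A"
proof -
  have [measurable]: "(\<lambda>x. x i) \<in> prodM \<rightarrow>\<^sub>M M i" using i by (rule measurable_component_singleton)
  have [measurable]: "gibbs_real w \<in> borel_measurable prodM"
    by (intro gibbs_real_measurable bounded_tuple_measurable w)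
  have [measurable]: "osum w \<in> borel_measurable prodM"
    by (intro osum_measurable bounded_tuple_measurable w)
  note int = dual_bounded_tuple(2,3)[OF w]
  have ind_int: "integrable (M i) (indicator A :: 'a \<Rightarrow> real)"
    by (intro M.integrable_const_bound[where B = 1]) (auto simp: indicator_def)
  note ind = integral_component[OF refl PiM_component[OF i] i ind_int]
  show gi: "integrable prodM (\<lambda>x. gibbs_real w x * indicator A (x i))"
    by (rule Bochner_Integration.integrable_bound[OF int(2)]) (auto simp: indicator_def)
  define b where "b = (\<integral>x. gibbs_real w x * indicator A (x i) \<partial>prodM)"
  \<comment> \<open>The energy lost when \<open>t\<close> times the indicator of \<open>A\<close> is
    added to the \<open>i\<close>-th potential. It is explicit in \<open>t\<close>, since the
    exponential of a multiple of an indicator is affine in the indicator; no differentiation under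
    the integral occurs.\<close>
  define \<psi> where "\<psi> t = e * (exp (t / e) - 1) * b - t * measure (M i) A" for t
  have "\<psi> 0 \<le> \<psi> t" for t
  proof -
    define u where "u = w(i := \<lambda>x. w i x + t * indicator A x)"
    have u: "bounded_tuple u"
      unfolding bounded_tuple_def
    proof (intro ballI conjI)
      fix j assume j: "j \<in> {1..N}"
      have [measurable]: "w j \<in> borel_measurable (M j)" "w i \<in> borel_measurable (M i)"
        using w i j by (auto intro: bounded_tuple_measurable)
      show "u j \<in> borel_measurable (M j)" by (cases "j = i") (auto simp: u_def)
      obtain R where R: "\<And>x. x \<in> space (M j) \<Longrightarrow> \<bar>w j x\<bar> \<le> R"
        using w j unfolding bounded_tuple_def by metis
      have "\<forall>x\<in>space (M j). \<bar>u j x\<bar> \<le> R + \<bar>t\<bar>"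
        using R by (force simp: u_def indicator_def)
      then show "\<exists>R. \<forall>x\<in>space (M j). \<bar>u j x\<bar> \<le> R" by blast
    qed
    have osum_u: "osum u x = osum w x + t * indicator A (x i)" for x
    proof -
      have "(\<Sum>j\<in>{1..N} - {i}. u j (x j)) = (\<Sum>j\<in>{1..N} - {i}. w j (x j))"
        by (intro sum.cong) (auto simp: u_def)
      then show ?thesis using i by (simp add: osum_def sum.remove[of "{1..N}" i] u_def)
    qed
    have "exp ((osum u x - c x) / e) = gibbs_real w x + (exp (t / e) - 1) * (gibbs_real w x * indicator A (x i))" for x
    proof (cases "x i \<in> A")
      case True
      have "(osum u x - c x) / e = (osum w x - c x) / e + t / e"
        using True by (simp add: osum_u add_divide_distrib diff_divide_distrib)
      then show ?thesis using True by (simp add: gibbs_real_def exp_add algebra_simps)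
    qed (simp add: osum_u gibbs_real_def)
    then have "energy (osum u) = (\<integral>x. (osum w x + t * indicator A (x i)) -
        e * (gibbs_real w x + (exp (t / e) - 1) * (gibbs_real w x * indicator A (x i))) \<partial>prodM)"
      unfolding energy_def by (simp add: osum_u)
    also have "\<dots> = ((\<integral>x. osum w x \<partial>prodM) + t * measure (M i) A)
        - e * ((\<integral>x. gibbs_real w x \<partial>prodM) + (exp (t / e) - 1) * b)"
      using int ind gi by (simp add: b_def)
    also have "\<dots> = energy (osum w) - \<psi> t"
    proof -
      have "energy (osum w) = (\<integral>x. osum w x \<partial>prodM) - e * (\<integral>x. gibbs_real w x \<partial>prodM)"
        using int unfolding energy_def gibbs_real_def[symmetric] by simp
      then show ?thesis by (simp add: \<psi>_def algebra_simps)
    qed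
    finally have "energy (osum u) = energy (osum w) - \<psi> t" .
    then show ?thesis using max[OF u] by (simp add: \<psi>_def[of 0])
  qed
  moreover have "(\<psi> has_real_derivative e * (exp (0 / e) * (1 / e)) * b - measure (M i) A) (at 0)"
    unfolding \<psi>_def[abs_def] using e_pos by (auto intro!: derivative_eq_intros)
  ultimately have "e * (exp (0 / e) * (1 / e)) * b - measure (M i) A = 0"
    by (intro DERIV_local_min[of \<psi> _ 0 1]) auto
  then show "(\<integral>x. gibbs_real w x * indicator A (x i) \<partial>prodM) = measure (M i) A"
    using e_pos by (simp add: b_def)
qed

lemma maximizer_coupling:
  assumes w: "bounded_tuple w" and max: "\<And>u. bounded_tuple u \<Longrightarrow> energy (osum u) \<le> energy (osum w)"
  shows "density prodM (gibbs_real w) \<in> couplings N M"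
proof -
  let ?\<gamma> = "density prodM (gibbs_real w)"
  have [measurable]: "gibbs_real w \<in> borel_measurable prodM"
    by (intro gibbs_real_measurable bounded_tuple_measurable w)
  have marg: "distr ?\<gamma> (M i) (\<lambda>x. x i) = M i" if i: "i \<in> {1..N}" for i
  proof (rule measure_eqI)
    fix A assume "A \<in> sets (distr ?\<gamma> (M i) (\<lambda>x. x i))"
    then have A [measurable]: "A \<in> sets (M i)" by simp
    have [measurable]: "(\<lambda>x. x i) \<in> prodM \<rightarrow>\<^sub>M M i" using i by (rule measurable_component_singleton)
    have "emeasure (distr ?\<gamma> (M i) (\<lambda>x. x i)) A = (\<integral>\<^sup>+x. ennreal (gibbs_real w x) * indicator ((\<lambda>x. x i) -` A \<inter> space prodM) x \<partial>prodM)"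
      by (simp add: emeasure_distr emeasure_density)
    also have "\<dots> = (\<integral>\<^sup>+x. ennreal (gibbs_real w x * indicator A (x i)) \<partial>prodM)"
      by (intro nn_integral_cong) (auto simp: indicator_def)
    also have "\<dots> = ennreal (measure (M i) A)"
      using maximizer_marginal[OF w max i A]
      by (subst nn_integral_eq_integral) (auto simp: gibbs_real_def)
    finally show "emeasure (distr ?\<gamma> (M i) (\<lambda>x. x i)) A = emeasure (M i) A"
      by (simp add: M.emeasure_eq_measure)
  qed simp
  \<comment> \<open>The total mass is read off a marginal: a push-forward is a probability measure
    only if the original measure is one.\<close>
  have "prob_space (distr ?\<gamma> (M 1) (\<lambda>x. x 1))"
    using marg[of 1] prob_space_M[of 1] N_pos by simp
  moreover have "(\<lambda>x. x 1) \<in> ?\<gamma> \<rightarrow>\<^sub>M M 1"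
    using measurable_component_singleton[of 1 "{1..N}" M] N_pos by simp
  ultimately have "prob_space ?\<gamma>"
    using prob_space_distrD by blast
  then show ?thesis using marg by (simp add: couplings_def)
qed

text \<open>The entropy integrand is bounded below, so on a probability space its integral can be
  infinite only from above; a cost other than \<open>\<infinity>\<close> therefore comes from an
  integrable function and a real density.\<close>

lemma schroedinger_cost_finite:
  assumes \<gamma>: "\<gamma> \<in> couplings N M" and fin: "schroedinger_cost N e c M \<gamma> \<noteq> \<infinity>"
  obtains g where "g \<in> borel_measurable prodM" "\<And>x. 0 \<le> g x" "\<gamma> = density prodM (\<lambda>x. ennreal (g x))"
    "integrable prodM (\<lambda>x. g x * ln (g x / exp (- c x / e)))"
    "schroedinger_cost N e c M \<gamma> = ereal (e * (\<integral>x. g x * ln (g x / exp (- c x / e)) \<partial>prodM))"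
proof -
  interpret \<gamma>: prob_space \<gamma> using \<gamma> by (simp add: couplings_def)
  have s: "sets \<gamma> = sets prodM" using \<gamma> by (simp add: couplings_def)
  have kl: "KL prodM (\<lambda>x. exp (- c x / e)) \<gamma> \<noteq> \<infinity>"
    using fin e_pos unfolding schroedinger_cost_def by auto
  then have ac: "absolutely_continuous prodM \<gamma>" unfolding KL_def by (auto split: if_splits)
  define g where "g x = enn2real (RN_deriv prodM \<gamma> x)" for x
  have [measurable]: "g \<in> borel_measurable prodM" unfolding g_def[abs_def] by measurable
  have "AE x in prodM. RN_deriv prodM \<gamma> x \<noteq> \<infinity>"
    by (rule P.RN_deriv_finite[OF _ ac s]) unfold_locales
  then have "AE x in prodM. RN_deriv prodM \<gamma> x = ennreal (g x)"
    by eventually_elim (simp add: g_def less_top)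
  then have "density prodM (RN_deriv prodM \<gamma>) = density prodM (\<lambda>x. ennreal (g x))"
    by (intro density_cong) auto
  then have \<gamma>_eq: "\<gamma> = density prodM (\<lambda>x. ennreal (g x))"
    using P.density_RN_deriv[OF ac s] by simp
  define q where "q x = g x * ln (g x / exp (- c x / e))" for x
  have [measurable]: "q \<in> borel_measurable prodM" unfolding q_def[abs_def] by measurable
  have KL: "KL prodM (\<lambda>x. exp (- c x / e)) \<gamma> = ext_integral prodM (\<lambda>x. ereal (q x))"
    using ac by (simp add: KL_def Let_def q_def g_def)
  have q: "- exp (B / e) \<le> q x" if "x \<in> space prodM" for x
  proof -
    \<comment> \<open>Young's inequality at \<open>a = c x / e\<close> and \<open>p = - a\<close>,
      where the linear term drops out.\<close>
    have "0 \<le> q x + exp (- (c x / e)) - g x"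
      using fenchel_identity(3)[of "g x" "c x / e" "- (c x / e)"] by (simp add: q_def g_def)
    moreover have "exp (- (c x / e)) \<le> exp (B / e)"
      using c_bounded[OF that] e_pos divide_right_mono[of "- c x" B e] by simp
    moreover have "0 \<le> g x" by (simp add: g_def)
    ultimately show ?thesis by linarith
  qed
  have "(\<integral>\<^sup>+x. ennreal (- q x) \<partial>prodM) \<le> (\<integral>\<^sup>+x. ennreal (exp (B / e)) \<partial>prodM)"
    using q by (intro nn_integral_mono ennreal_leI) (simp add: minus_le_iff)
  also have "\<dots> < \<infinity>" by (simp add: P.emeasure_space_1)
  finally have neg: "(\<integral>\<^sup>+x. ennreal (- q x) \<partial>prodM) < \<infinity>" .
  have pos: "(\<integral>\<^sup>+x. ennreal (q x) \<partial>prodM) < \<infinity>"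
  proof (rule ccontr)
    assume "\<not> ?thesis"
    then have "(\<integral>\<^sup>+x. ennreal (q x) \<partial>prodM) = \<top>" by (simp add: less_top[symmetric])
    then have "ext_integral prodM (\<lambda>x. ereal (q x)) = \<infinity>"
      using neg unfolding ext_integral_def
      by (cases "\<integral>\<^sup>+x. ennreal (- q x) \<partial>prodM") auto
    then show False using kl KL by simp
  qed
  have q_int: "integrable prodM q" using pos neg by (auto simp: real_integrable_def)
  show thesis
  proof (rule that)
    show "schroedinger_cost N e c M \<gamma> = ereal (e * (\<integral>x. g x * ln (g x / exp (- c x / e)) \<partial>prodM))"
      unfolding schroedinger_cost_def KL ext_integral_real[OF q_int] by (simp add: q_def[abs_def])
    show "integrable prodM (\<lambda>x. g x * ln (g x / exp (- c x / e)))"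
      using q_int unfolding q_def[abs_def] .
    show "0 \<le> g x" for x by (simp add: g_def)
  qed (rule \<open>g \<in> borel_measurable prodM\<close> \<gamma>_eq)+
qed

text \<open>The marginal condition turns the sum of the integrals of the potentials into the
  integral of \<open>g * osum r\<close>, so that cost, dual value and both masses merge into one
  integral over the product.\<close>

lemma weak_duality_finite:
  assumes \<gamma>: "\<gamma> \<in> couplings N M" and fin: "schroedinger_cost N e c M \<gamma> \<noteq> \<infinity>"
    and v: "v \<in> dual_dom N e M" and dv: "dual N e c M v \<noteq> -\<infinity>"
  shows "dual N e c M v + ereal e \<le> schroedinger_cost N e c M \<gamma>"
    and "dual N e c M v + ereal e = schroedinger_cost N e c M \<gamma> \<Longrightarrow> \<gamma> = density prodM (gibbs N e c v)"
proof -
  interpret \<gamma>: prob_space \<gamma> using \<gamma> by (simp add: couplings_def)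
  have s: "sets \<gamma> = sets prodM" and marg: "\<And>i. i \<in> {1..N} \<Longrightarrow> distr \<gamma> (M i) (\<lambda>x. x i) = M i"
    using \<gamma> by (auto simp: couplings_def)
  define r where "r i x = real_of_ereal (v i x)" for i x
  note D = dual_finite[OF v dv, folded r_def]
  have r_int: "integrable (M i) (r i)" if "i \<in> {1..N}" for i using D(2)[OF that] by (simp add: r_def[abs_def])
  have [measurable]: "r i \<in> borel_measurable (M i)" if "i \<in> {1..N}" for i using r_int[OF that] by auto
  have G_int: "integrable prodM (gibbs_real r)" and G_ae: "AE x in prodM. gibbs N e c v x = ennreal (gibbs_real r x)"
    and dual: "dual N e c M v = ereal ((\<Sum>i\<in>{1..N}. \<integral>x. r i x \<partial>M i) - e * (\<integral>x. gibbs_real r x \<partial>prodM))"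
    using D by (simp_all add: r_def[abs_def])
  obtain g where g [measurable]: "g \<in> borel_measurable prodM" and g0: "\<And>x. 0 \<le> g x"
    and \<gamma>_eq: "\<gamma> = density prodM (\<lambda>x. ennreal (g x))"
    and q_int: "integrable prodM (\<lambda>x. g x * ln (g x / exp (- c x / e)))"
    and cost: "schroedinger_cost N e c M \<gamma> = ereal (e * (\<integral>x. g x * ln (g x / exp (- c x / e)) \<partial>prodM))"
    by (rule schroedinger_cost_finite[OF \<gamma> fin]) (rule that; assumption)
  define q where "q x = g x * ln (g x / exp (- c x / e))" for x
  have q_int: "integrable prodM q" using q_int by (simp add: q_def[abs_def])
  have osum: "integrable \<gamma> (osum r)" "(\<integral>x. osum r x \<partial>\<gamma>) = (\<Sum>i\<in>{1..N}. \<integral>x. r i x \<partial>M i)"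
    using integral_osum[OF s marg r_int] by auto
  have go_int: "integrable prodM (\<lambda>x. g x * osum r x)"
    using osum(1) unfolding \<gamma>_eq by (subst (asm) integrable_density) (auto simp: g0)
  have go: "(\<integral>x. g x * osum r x \<partial>prodM) = (\<Sum>i\<in>{1..N}. \<integral>x. r i x \<partial>M i)"
    using osum(2) unfolding \<gamma>_eq by (subst (asm) integral_density) (auto simp: g0)
  have "integrable \<gamma> (\<lambda>_. 1 :: real)" by simp
  then have g_int: "integrable prodM g"
    unfolding \<gamma>_eq by (subst (asm) integrable_density) (auto simp: g0)
  have "(\<integral>x. (1 :: real) \<partial>\<gamma>) = (\<integral>x. g x *\<^sub>R 1 \<partial>prodM)"
    unfolding \<gamma>_eq by (rule integral_density) (auto simp: g0)
  then have g1: "(\<integral>x. g x \<partial>prodM) = 1" by (simp add: \<gamma>.prob_space)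
  \<comment> \<open>The pointwise duality gap divided by \<open>e\<close>. The last term integrates
    to \<open>1\<close>, which produces the summand \<open>ereal e\<close> of the claim.\<close>
  define d where "d x = q x - g x * osum r x / e + gibbs_real r x - g x" for x
  have d_eq: "d x = g x * ln (g x / exp (- (c x / e))) - g x * ((osum r x - c x) / e + c x / e)
      + exp ((osum r x - c x) / e) - g x" for x
    by (simp add: d_def q_def gibbs_real_def diff_divide_distrib)
  have d_nonneg: "0 \<le> d x" for x unfolding d_eq by (rule fenchel_identity(3)[OF g0])
  have d_int: "integrable prodM d" unfolding d_def using q_int go_int G_int g_int by simp
  have int_d: "(\<integral>x. d x \<partial>prodM) = (\<integral>x. q x \<partial>prodM) - (\<Sum>i\<in>{1..N}. \<integral>x. r i x \<partial>M i) / e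
      + (\<integral>x. gibbs_real r x \<partial>prodM) - 1"
    unfolding d_def using q_int go_int G_int g_int by (simp add: go g1)
  have cost': "schroedinger_cost N e c M \<gamma> = dual N e c M v + ereal e + ereal (e * (\<integral>x. d x \<partial>prodM))"
    unfolding cost dual int_d q_def[symmetric] using e_pos by (simp add: field_simps)
  have "0 \<le> (\<integral>x. d x \<partial>prodM)" using d_nonneg by simp
  then show "dual N e c M v + ereal e \<le> schroedinger_cost N e c M \<gamma>"
    unfolding cost' dual using e_pos by simp
  assume "dual N e c M v + ereal e = schroedinger_cost N e c M \<gamma>"
  then have "(\<integral>x. d x \<partial>prodM) = 0" unfolding cost' dual using e_pos by simp
  then have "AE x in prodM. d x = 0" using integral_nonneg_eq_0_iff_AE[OF d_int] d_nonneg by auto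
  with G_ae have "AE x in prodM. ennreal (g x) = gibbs N e c v x"
  proof eventually_elim
    case (elim x)
    have "g x = exp ((osum r x - c x) / e)"
      using fenchel_identity(4)[OF g0] elim(2) unfolding d_eq by blast
    then show ?case using elim(1) by (simp add: gibbs_real_def)
  qed
  then show "\<gamma> = density prodM (gibbs N e c v)"
    unfolding \<gamma>_eq using dual_dom_measurable[OF v] by (intro density_cong) auto
qed

lemma weak_duality:
  assumes "\<gamma> \<in> couplings N M" "v \<in> dual_dom N e M"
  shows "dual N e c M v + ereal e \<le> schroedinger_cost N e c M \<gamma>"
  using weak_duality_finite(1)[OF assms(1) _ assms(2)]
  by (cases "schroedinger_cost N e c M \<gamma> = \<infinity>"; cases "dual N e c M v = -\<infinity>") auto

text \<open>Dividing the Gibbs density by \<open>exp (- c x / e)\<close> leaves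
  \<open>exp (osum w x / e)\<close>, so the divergence is the integral of \<open>osum w / e\<close>
  against the coupling; equal marginals replace the coupling by the product measure. Unit mass
  accounts for \<open>ereal e\<close>.\<close>

lemma maximizer_cost:
  assumes w: "bounded_tuple w" and coup: "density prodM (gibbs_real w) \<in> couplings N M"
  shows "schroedinger_cost N e c M (density prodM (gibbs_real w)) = ereal (energy (osum w)) + ereal e"
proof -
  let ?\<gamma> = "density prodM (\<lambda>x. ennreal (gibbs_real w x))"
  interpret \<gamma>: prob_space ?\<gamma> using coup by (simp add: couplings_def)
  have [measurable]: "gibbs_real w \<in> borel_measurable prodM"
    by (intro gibbs_real_measurable bounded_tuple_measurable w)
  have [measurable]: "osum w \<in> borel_measurable prodM"
    by (intro osum_measurable bounded_tuple_measurable w)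
  note int = dual_bounded_tuple(2,3)[OF w]
  have G0: "0 \<le> gibbs_real w x" for x by (simp add: gibbs_real_def)
  have marg: "\<And>i. i \<in> {1..N} \<Longrightarrow> distr ?\<gamma> (M i) (\<lambda>x. x i) = M i"
    using coup by (auto simp: couplings_def)
  have osum: "integrable ?\<gamma> (osum w)" "(\<integral>x. osum w x \<partial>?\<gamma>) = (\<integral>x. osum w x \<partial>prodM)"
    using integral_osum[OF sets_density marg bounded_tuple_integrable[OF w]]
      integral_osum(2)[OF refl PiM_component bounded_tuple_integrable[OF w]] by auto
  have go_int: "integrable prodM (\<lambda>x. gibbs_real w x * osum w x / e)"
    using osum(1) by (subst (asm) integrable_density) (auto simp: G0)
  have go: "(\<integral>x. gibbs_real w x * osum w x \<partial>prodM) = (\<integral>x. osum w x \<partial>prodM)"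
    using osum(2) by (subst (asm) integral_density) (auto simp: G0)
  have "(\<integral>x. (1 :: real) \<partial>?\<gamma>) = (\<integral>x. gibbs_real w x *\<^sub>R 1 \<partial>prodM)"
    by (rule integral_density) (auto simp: G0)
  then have G1: "(\<integral>x. gibbs_real w x \<partial>prodM) = 1" using \<gamma>.prob_space by simp
  have RN: "AE x in prodM. ennreal (gibbs_real w x) = RN_deriv prodM ?\<gamma> x"
    by (rule P.RN_deriv_unique) simp_all
  have ac: "absolutely_continuous prodM ?\<gamma>"
    by (rule absolutely_continuousI_density) simp
  have "KL prodM (\<lambda>x. exp (- c x / e)) ?\<gamma> = ext_integral prodM (\<lambda>x. ereal (gibbs_real w x * osum w x / e))"
    unfolding KL_def using ac
  proof (simp only: if_True, intro ext_integral_cong_AE)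
    show "AE x in prodM. (let g = enn2real (RN_deriv prodM ?\<gamma> x) in ereal (g * ln (g / exp (- c x / e))))
        = ereal (gibbs_real w x * osum w x / e)"
      using RN
    proof eventually_elim
      case (elim x)
      have "enn2real (RN_deriv prodM ?\<gamma> x) = gibbs_real w x"
        unfolding elim[symmetric] by (simp add: G0)
      moreover have "gibbs_real w x / exp (- c x / e) = exp (osum w x / e)"
        by (simp add: gibbs_real_def exp_diff[symmetric] diff_divide_distrib)
      ultimately show ?case by (simp add: Let_def)
    qed
  qed
  then have "schroedinger_cost N e c M ?\<gamma> = ereal (\<integral>x. osum w x \<partial>prodM)"
    unfolding schroedinger_cost_def using ext_integral_real[OF go_int] go e_pos by simp
  moreover have "energy (osum w) = (\<integral>x. osum w x \<partial>prodM) - e"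
    using int G1 unfolding energy_def gibbs_real_def[symmetric] by simp
  ultimately show ?thesis by simp
qed

text \<open>On one good section per coordinate all other potentials are frozen, so the two
  \<open>i\<close>-th potentials differ there by a constant.\<close>

lemma osum_eq_AE_imp_shift:
  assumes "AE x in prodM. osum r x = osum s x"
  obtains t where "(\<Sum>i\<in>{1..N}. t i) = 0" "\<And>i. i \<in> {1..N} \<Longrightarrow> AE z in M i. r i z = s i z + t i"
proof -
  have "\<exists>t. AE z in M i. r i z = s i z + t" if i: "i \<in> {1..N}" for i
  proof -
    obtain y where y: "AE z in M i. osum r (y(i := z)) = osum s (y(i := z))"
      using AE_section[OF i assms] by blast
    then have "AE z in M i. r i z = s i z
        + ((\<Sum>j\<in>{1..N} - {i}. s j (y j)) - (\<Sum>j\<in>{1..N} - {i}. r j (y j)))"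
      unfolding osum_fun_upd[OF i] by (rule eventually_mono) linarith
    then show ?thesis by blast
  qed
  then obtain t where t: "\<And>i. i \<in> {1..N} \<Longrightarrow> AE z in M i. r i z = s i z + t i" by metis
  have "AE x in prodM. \<forall>i\<in>{1..N}. r i (x i) = s i (x i) + t i"
    by (intro eventually_ball_finite ballI AE_component t) auto
  with assms have "AE x in prodM. (\<Sum>i\<in>{1..N}. t i) = 0"
  proof eventually_elim
    case (elim x)
    have "osum r x = osum s x + (\<Sum>i\<in>{1..N}. t i)"
      unfolding osum_def using elim(2) by (simp add: sum.distrib)
    then show ?case using elim(1) by simp
  qed
  \<comment> \<open>The assertion does not involve the point, and a probability space is not a null
    set.\<close>
  then have "(\<Sum>i\<in>{1..N}. t i) = 0" by (simp add: P.AE_const)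
  then show thesis using t by (rule that)
qed

end

section \<open>The duality theorem\<close>

context entropic_ot
begin

text \<open>Claimed on the space of \<open>M 1\<close>, where the bounds on
  \<open>partial_mass\<close> apply and the extended logarithm takes a real value.\<close>

lemma c_transform1_eq:
  assumes u: "u \<in> dual_dom N e M" and x: "x \<in> space (M 1)"
  shows "c_transform1 N e c M u x = ereal (transform 1 u x)"
proof -
  have J: "{1..N} - {1} = {2..N}" by auto
  have "c_transform1 N e c M u x = - (ereal e * log_ext (partial_mass 1 u x))"
    unfolding c_transform1_def partial_mass_def J ..
  also have "\<dots> = ereal (transform 1 u x)"
    using partial_mass_transform(1)[OF _ u x] N_pos e_pos by (simp add: log_ext_def)
  finally show ?thesis .
qed

text \<open>If the new value is \<open>-\<infinity>\<close>, so is the old one, and their equality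
  says nothing about \<open>u 1\<close>; hence the finiteness condition in the last claim.\<close>

lemma c_transform1_improves:
  fixes u :: "nat \<Rightarrow> 'a \<Rightarrow> ereal"
  assumes u: "u \<in> dual_dom N e M"
  defines "v \<equiv> u(1 := c_transform1 N e c M u)"
  shows "c_transform1 N e c M u \<in> Lexp e (M 1)"
    and "dual N e c M u \<le> dual N e c M v"
    and "AE x in M 1. u 1 x = c_transform1 N e c M u x \<Longrightarrow> dual N e c M v = dual N e c M u"
    and "dual N e c M v \<noteq> -\<infinity> \<Longrightarrow> dual N e c M v = dual N e c M u \<Longrightarrow>
      AE x in M 1. u 1 x = c_transform1 N e c M u x"
proof -
  have one: "1 \<in> {1..N}" using N_pos by simp
  let ?t = "\<lambda>x. ereal (transform 1 u x)"
  note eq = c_transform1_eq[OF u]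
  have t: "?t \<in> Lexp e (M 1)" by (rule transform_in_Lexp[OF one u])
  have "c_transform1 N e c M u \<in> borel_measurable (M 1) \<longleftrightarrow> ?t \<in> borel_measurable (M 1)"
    by (intro measurable_cong eq)
  moreover have "(\<integral>\<^sup>+x. exp_ext (c_transform1 N e c M u x / ereal e) \<partial>M 1) = (\<integral>\<^sup>+x. exp_ext (?t x / ereal e) \<partial>M 1)"
    by (intro nn_integral_cong) (simp only: eq)
  ultimately show "c_transform1 N e c M u \<in> Lexp e (M 1)"
    using t by (simp add: Lexp_def eq)
  have v: "dual N e c M v = dual N e c M (u(1 := ?t))"
    unfolding v_def using eq by (intro dual_cong_AE AE_I2) auto
  show "dual N e c M u \<le> dual N e c M v"
    unfolding v by (rule dual_le_dual_transform[OF one u])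
  show "dual N e c M v = dual N e c M u" if "AE x in M 1. u 1 x = c_transform1 N e c M u x"
    unfolding v_def using that by (intro dual_cong_AE) auto
  show "AE x in M 1. u 1 x = c_transform1 N e c M u x"
    if "dual N e c M v \<noteq> -\<infinity>" "dual N e c M v = dual N e c M u"
  proof -
    have "AE x in M 1. u 1 x = ?t x"
      using that unfolding v by (intro dual_transform_eq_imp[OF one u]) auto
    then show ?thesis using AE_space by eventually_elim (simp add: eq)
  qed
qed

lemma dual_optimizer:
  obtains w where "bounded_tuple w"
    and "density prodM (gibbs N e c (\<lambda>i x. ereal (w i x))) \<in> couplings N M"
    and "schroedinger_cost N e c M (density prodM (gibbs N e c (\<lambda>i x. ereal (w i x))))
      = dual N e c M (\<lambda>i x. ereal (w i x)) + ereal e"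
proof -
  obtain w where w: "bounded_tuple w" "\<And>u. bounded_tuple u \<Longrightarrow> energy (osum u) \<le> energy (osum w)"
    using exists_bounded_maximizer by metis
  have g: "gibbs N e c (\<lambda>i x. ereal (w i x)) = (\<lambda>x. ennreal (gibbs_real w x))"
    by (simp add: gibbs_ereal fun_eq_iff)
  show thesis
    using that[OF w(1)] maximizer_coupling[OF w] maximizer_cost[OF w(1) maximizer_coupling[OF w]]
    unfolding g dual_bounded_tuple(1)[OF w(1)] by simp
qed

lemma entropic_duality:
  "\<exists>u0\<in>dual_dom N e M.
     dual N e c M u0 = (SUP u\<in>dual_dom N e M. dual N e c M u) \<and>
     (\<forall>v\<in>dual_dom N e M.
        dual N e c M v = (SUP u\<in>dual_dom N e M. dual N e c M u) \<longleftrightarrow>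
        (\<exists>t::nat \<Rightarrow> real. (\<Sum>i\<in>{1..N}. t i) = 0 \<and>
           (\<forall>i\<in>{1..N}. AE x in M i. v i x = u0 i x + ereal (t i)))) \<and>
     (\<forall>i\<in>{1..N}. u0 i \<in> Linfty (M i)) \<and>
     {\<gamma> \<in> couplings N M. schroedinger_cost N e c M \<gamma> = OT N e c M} =
       {density prodM (gibbs N e c u0)}"
  "OT N e c M = (SUP u\<in>dual_dom N e M. dual N e c M u) + ereal e"
proof -
  obtain w where w: "bounded_tuple w"
    and coup: "density prodM (gibbs N e c (\<lambda>i x. ereal (w i x))) \<in> couplings N M"
    and cost: "schroedinger_cost N e c M (density prodM (gibbs N e c (\<lambda>i x. ereal (w i x))))
      = dual N e c M (\<lambda>i x. ereal (w i x)) + ereal e"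
    by (rule dual_optimizer)
  define u0 where "u0 = (\<lambda>i x. ereal (w i x))"
  define \<gamma>0 where "\<gamma>0 = density prodM (gibbs N e c u0)"
  note coup = coup[folded u0_def, folded \<gamma>0_def] and cost = cost[folded u0_def, folded \<gamma>0_def]
  have u0: "u0 \<in> dual_dom N e M" unfolding u0_def by (rule bounded_tuple_dual_dom[OF w])
  have du0: "dual N e c M u0 = ereal (energy (osum w))"
    unfolding u0_def by (rule dual_bounded_tuple(1)[OF w])
  \<comment> \<open>Weak duality against \<open>\<gamma>0\<close> alone: this covers all
    competitors, including unbounded ones and those with value \<open>-\<infinity>\<close>.\<close>
  have "dual N e c M v \<le> dual N e c M u0" if "v \<in> dual_dom N e M" for v
    using weak_duality[OF coup that] unfolding cost du0 by (cases "dual N e c M v") auto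
  then have sup: "(SUP u\<in>dual_dom N e M. dual N e c M u) = dual N e c M u0"
    using u0 by (intro antisym SUP_least SUP_upper)
  have OT: "OT N e c M = dual N e c M u0 + ereal e"
    unfolding OT_def
  proof (rule antisym)
    show "(INF \<gamma>\<in>couplings N M. schroedinger_cost N e c M \<gamma>) \<le> dual N e c M u0 + ereal e"
      unfolding cost[symmetric] by (rule INF_lower[OF coup])
    show "dual N e c M u0 + ereal e \<le> (INF \<gamma>\<in>couplings N M. schroedinger_cost N e c M \<gamma>)"
      by (intro INF_greatest weak_duality u0)
  qed
  then show "OT N e c M = (SUP u\<in>dual_dom N e M. dual N e c M u) + ereal e" unfolding sup .
  have shift: "dual N e c M v = dual N e c M u0 \<longleftrightarrow>
      (\<exists>t::nat \<Rightarrow> real. (\<Sum>i\<in>{1..N}. t i) = 0 \<and> (\<forall>i\<in>{1..N}. AE x in M i. v i x = u0 i x + ereal (t i)))"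
    if v: "v \<in> dual_dom N e M" for v
  proof
    assume eq: "dual N e c M v = dual N e c M u0"
    then have fin: "dual N e c M v \<noteq> -\<infinity>" using du0 by simp
    define r where "r i x = real_of_ereal (v i x)" for i x
    note D = dual_finite[OF v fin, folded r_def]
    have vr: "AE x in M i. v i x = ereal (r i x)" if "i \<in> {1..N}" for i using D(1)[OF that] .
    \<comment> \<open>Any further maximizer has zero gap with the same \<open>\<gamma>0\<close>, and
      equality in weak duality identifies its Gibbs measure; taking logarithms then compares the
      sums of the potentials.\<close>
    have "\<gamma>0 = density prodM (gibbs N e c v)"
      using weak_duality_finite(2)[OF coup _ v fin] unfolding cost eq du0 by simp
    then have "AE x in prodM. gibbs N e c u0 x = gibbs N e c v x"
      unfolding \<gamma>0_def using dual_dom_measurable[OF v] dual_dom_measurable[OF u0]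
      by (subst (asm) P.density_unique_iff) auto
    moreover have "AE x in prodM. gibbs N e c v x = gibbs N e c (\<lambda>i x. ereal (r i x)) x"
      by (rule gibbs_cong_AE[OF vr])
    ultimately have "AE x in prodM. osum r x = osum w x"
    proof eventually_elim
      case (elim x)
      then have "ennreal (gibbs_real r x) = ennreal (gibbs_real w x)" by (simp add: u0_def gibbs_ereal)
      then have "gibbs_real r x = gibbs_real w x" by (simp add: gibbs_real_def)
      then show ?case using e_pos by (simp add: gibbs_real_def)
    qed
    then obtain t where t: "(\<Sum>i\<in>{1..N}. t i) = 0" "\<And>i. i \<in> {1..N} \<Longrightarrow> AE z in M i. r i z = w i z + t i"
      by (rule osum_eq_AE_imp_shift) (rule that; assumption)
    have "AE x in M i. v i x = u0 i x + ereal (t i)" if "i \<in> {1..N}" for i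
      using vr[OF that] t(2)[OF that] by eventually_elim (simp add: u0_def)
    with t(1) show "\<exists>t::nat \<Rightarrow> real. (\<Sum>i\<in>{1..N}. t i) = 0 \<and> (\<forall>i\<in>{1..N}. AE x in M i. v i x = u0 i x + ereal (t i))"
      by blast
  next
    assume "\<exists>t::nat \<Rightarrow> real. (\<Sum>i\<in>{1..N}. t i) = 0 \<and> (\<forall>i\<in>{1..N}. AE x in M i. v i x = u0 i x + ereal (t i))"
    then obtain t :: "nat \<Rightarrow> real" where t: "(\<Sum>i\<in>{1..N}. t i) = 0"
      "\<And>i. i \<in> {1..N} \<Longrightarrow> AE x in M i. v i x = u0 i x + ereal (t i)" by blast
    \<comment> \<open>A bounded real representative of \<open>v\<close>, which may itself be
      infinite on null sets; the shifts cancel, so its sum is that of \<open>w\<close>.\<close>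
    define s where "s i x = w i x + t i" for i x
    have s: "bounded_tuple s"
      unfolding bounded_tuple_def
    proof (intro ballI conjI)
      fix i assume i: "i \<in> {1..N}"
      have [measurable]: "w i \<in> borel_measurable (M i)" using w i by (rule bounded_tuple_measurable)
      show "s i \<in> borel_measurable (M i)" unfolding s_def by measurable
      obtain R where R: "\<And>x. x \<in> space (M i) \<Longrightarrow> \<bar>w i x\<bar> \<le> R"
        using w i unfolding bounded_tuple_def by metis
      have "\<bar>s i x\<bar> \<le> R + \<bar>t i\<bar>" if "x \<in> space (M i)" for x
        using R[OF that] unfolding s_def by linarith
      then show "\<exists>R. \<forall>x\<in>space (M i). \<bar>s i x\<bar> \<le> R" by blast
    qed
    have "dual N e c M v = dual N e c M (\<lambda>i x. ereal (s i x))"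
      using t(2) by (intro dual_cong_AE) (simp add: u0_def s_def)
    moreover have "osum s = osum w"
      using t(1) by (simp add: osum_def s_def sum.distrib fun_eq_iff)
    ultimately show "dual N e c M v = dual N e c M u0"
      by (simp add: du0 dual_bounded_tuple(1)[OF s])
  qed
  have Linf: "u0 i \<in> Linfty (M i)" if i: "i \<in> {1..N}" for i
  proof -
    obtain R where R: "\<And>x. x \<in> space (M i) \<Longrightarrow> \<bar>w i x\<bar> \<le> R"
      using w i unfolding bounded_tuple_def by metis
    then have "AE x in M i. \<bar>u0 i x\<bar> \<le> ereal R" by (auto simp: u0_def)
    then show ?thesis using dual_dom_measurable[OF u0 i] unfolding Linfty_def by blast
  qed
  have min: "{\<gamma> \<in> couplings N M. schroedinger_cost N e c M \<gamma> = OT N e c M} = {\<gamma>0}"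
  proof (intro equalityI subsetI)
    fix \<gamma> assume "\<gamma> \<in> {\<gamma> \<in> couplings N M. schroedinger_cost N e c M \<gamma> = OT N e c M}"
    then have \<gamma>: "\<gamma> \<in> couplings N M" "schroedinger_cost N e c M \<gamma> = dual N e c M u0 + ereal e"
      using OT by auto
    \<comment> \<open>The same equality case with the roles exchanged: an optimal coupling has zero
      gap with \<open>u0\<close>.\<close>
    then have "\<gamma> = density prodM (gibbs N e c u0)"
      using du0 by (intro weak_duality_finite(2)[OF \<gamma>(1) _ u0]) auto
    then show "\<gamma> \<in> {\<gamma>0}" by (simp add: \<gamma>0_def)
  qed (use coup cost OT in simp)
  show "\<exists>u0\<in>dual_dom N e M.
     dual N e c M u0 = (SUP u\<in>dual_dom N e M. dual N e c M u) \<and>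
     (\<forall>v\<in>dual_dom N e M.
        dual N e c M v = (SUP u\<in>dual_dom N e M. dual N e c M u) \<longleftrightarrow>
        (\<exists>t::nat \<Rightarrow> real. (\<Sum>i\<in>{1..N}. t i) = 0 \<and>
           (\<forall>i\<in>{1..N}. AE x in M i. v i x = u0 i x + ereal (t i)))) \<and>
     (\<forall>i\<in>{1..N}. u0 i \<in> Linfty (M i)) \<and>
     {\<gamma> \<in> couplings N M. schroedinger_cost N e c M \<gamma> = OT N e c M} =
       {density prodM (gibbs N e c u0)}"
    using shift Linf min unfolding sup \<gamma>0_def by (intro bexI[OF _ u0]) blast
qed

end

theorem theorem4p5:
  fixes N :: nat and X :: "nat \<Rightarrow> 'a metric" and \<rho> :: "nat \<Rightarrow> 'a measure"
    and c :: "(nat \<Rightarrow> 'a) \<Rightarrow> real" and \<epsilon> :: real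
  assumes "N \<ge> 1"
    and "\<And>i. i \<in> {1..N} \<Longrightarrow> polish_metric (X i)"
    and "\<And>i. i \<in> {1..N} \<Longrightarrow> borel_prob (X i) (\<rho> i)"
    and "c \<in> borel_measurable (borel_of (product_topology (\<lambda>i. mtopology_of (X i)) {1..N}))"
    and "bounded (c ` (\<Pi>\<^sub>E i\<in>{1..N}. mspace (X i)))"
    and "\<epsilon> > 0"
  shows
    "(\<forall>u\<in>dual_dom N \<epsilon> \<rho>.
       (\<forall>i\<in>{1..N}. (\<integral>\<^sup>+x. e2ennreal (u i x) \<partial>\<rho> i) < \<infinity>) \<and>
       gibbs N \<epsilon> c u \<in> borel_measurable (Pi\<^sub>M {1..N} \<rho>) \<and>
       (\<integral>\<^sup>+x. gibbs N \<epsilon> c u x \<partial>(Pi\<^sub>M {1..N} \<rho>)) < \<infinity> \<and>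
       dual N \<epsilon> c \<rho> u < \<infinity>) \<and>
     (\<forall>u\<in>dual_dom N \<epsilon> \<rho>.
       c_transform1 N \<epsilon> c \<rho> u \<in> Lexp \<epsilon> (\<rho> 1) \<and>
       dual N \<epsilon> c \<rho> (u(1 := c_transform1 N \<epsilon> c \<rho> u)) \<ge> dual N \<epsilon> c \<rho> u \<and>
       ((AE x in \<rho> 1. u 1 x = c_transform1 N \<epsilon> c \<rho> u x) \<longrightarrow>
          dual N \<epsilon> c \<rho> (u(1 := c_transform1 N \<epsilon> c \<rho> u)) = dual N \<epsilon> c \<rho> u) \<and>
       (dual N \<epsilon> c \<rho> (u(1 := c_transform1 N \<epsilon> c \<rho> u)) \<noteq> -\<infinity> \<longrightarrow>
          (dual N \<epsilon> c \<rho> (u(1 := c_transform1 N \<epsilon> c \<rho> u)) = dual N \<epsilon> c \<rho> u \<longleftrightarrow>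
             (AE x in \<rho> 1. u 1 x = c_transform1 N \<epsilon> c \<rho> u x)))) \<and>
     (\<exists>u0\<in>dual_dom N \<epsilon> \<rho>.
       dual N \<epsilon> c \<rho> u0 = (SUP u\<in>dual_dom N \<epsilon> \<rho>. dual N \<epsilon> c \<rho> u) \<and>
       (\<forall>v\<in>dual_dom N \<epsilon> \<rho>.
          dual N \<epsilon> c \<rho> v = (SUP u\<in>dual_dom N \<epsilon> \<rho>. dual N \<epsilon> c \<rho> u) \<longleftrightarrow>
          (\<exists>t::nat \<Rightarrow> real. (\<Sum>i\<in>{1..N}. t i) = 0 \<and>
             (\<forall>i\<in>{1..N}. AE x in \<rho> i. v i x = u0 i x + ereal (t i)))) \<and>
       (\<forall>i\<in>{1..N}. u0 i \<in> Linfty (\<rho> i)) \<and>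
       {\<gamma> \<in> couplings N \<rho>. schroedinger_cost N \<epsilon> c \<rho> \<gamma> = OT N \<epsilon> c \<rho>} =
         {density (Pi\<^sub>M {1..N} \<rho>) (gibbs N \<epsilon> c u0)}) \<and>
     (OT N \<epsilon> c \<rho> = (SUP u\<in>dual_dom N \<epsilon> \<rho>. dual N \<epsilon> c \<rho> u) + ereal \<epsilon>)"
proof -
  \<comment> \<open>A point mass fills the indices outside \<open>{1..N}\<close>, since the locale
    asks for a probability measure at each index; the notions in the statement see
    \<open>{1..N}\<close> only, so they agree for \<open>M\<close> and
    \<open>\<rho>\<close>.\<close>
  define M where "M i = (if i \<in> {1..N} then \<rho> i else return (count_space UNIV) undefined)" for i
  have M: "M i = \<rho> i" if "i \<in> {1..N}" for i using that by (simp only: M_def if_True)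
  have prob: "prob_space (M i)" for i
    using assms(3) by (auto simp: M_def borel_prob_def intro!: prob_space_return)
  have sets_M: "sets (M i) = sets (borel_of (mtopology_of (X i)))" if "i \<in> {1..N}" for i
    using assms(3)[OF that] M[OF that] by (simp add: borel_prob_def)
  have space_M: "space (PiM {1..N} M) = (\<Pi>\<^sub>E i\<in>{1..N}. mspace (X i))"
    unfolding space_PiM using sets_eq_imp_space_eq[OF sets_M]
    by (intro PiE_cong) (simp add: space_borel_of)
  obtain B where B: "\<And>x. x \<in> space (PiM {1..N} M) \<Longrightarrow> \<bar>c x\<bar> \<le> B"
    using assms(5) unfolding space_M bounded_iff by auto
  \<comment> \<open>Separability of the spaces enters here, by way of second countability.\<close>
  have sub: "sets (borel_of (product_topology (\<lambda>i. mtopology_of (X i)) {1..N})) \<subseteq> sets (PiM {1..N} M)"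
    using sets_borel_of_product_subset[of "{1..N}" "\<lambda>i. mtopology_of (X i)"] assms(2)
      sets_PiM_cong[OF refl sets_M, of "{1..N}"]
    by (simp add: polish_metric_def second_countable_mtopology_of)
  have c: "c \<in> borel_measurable (PiM {1..N} M)"
  proof (rule measurableI)
    fix A :: "real set" assume "A \<in> sets borel"
    then have "c -` A \<inter> space (borel_of (product_topology (\<lambda>i. mtopology_of (X i)) {1..N}))
        \<in> sets (borel_of (product_topology (\<lambda>i. mtopology_of (X i)) {1..N}))"
      by (rule measurable_sets[OF assms(4)])
    then show "c -` A \<inter> space (PiM {1..N} M) \<in> sets (PiM {1..N} M)"
      using sub unfolding space_M space_borel_of topspace_product_topology topspace_mtopology_of by blast
  qed simp
  interpret entropic_ot N M c \<epsilon> B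
    by (rule entropic_ot.intro[OF prob assms(1) c B assms(6)])
  have PM: "PiM {1..N} \<rho> = PiM {1..N} M" "PiM {2..N} \<rho> = PiM {2..N} M"
    using M by (auto intro!: PiM_cong)
  have one: "\<rho> 1 = M 1" using M[of 1] assms(1) by simp
  have dd: "dual_dom N \<epsilon> \<rho> = dual_dom N \<epsilon> M"
    unfolding dual_dom_def by (simp only: M cong: ball_cong)
  have du: "dual N \<epsilon> c \<rho> = dual N \<epsilon> c M"
    unfolding dual_def[abs_def] PM by (simp only: M cong: sum.cong)
  have ct: "c_transform1 N \<epsilon> c \<rho> = c_transform1 N \<epsilon> c M"
    unfolding c_transform1_def[abs_def] PM ..
  have co: "couplings N \<rho> = couplings N M"
    unfolding couplings_def PM by (simp only: M cong: ball_cong)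
  have sc: "schroedinger_cost N \<epsilon> c \<rho> = schroedinger_cost N \<epsilon> c M"
    unfolding schroedinger_cost_def[abs_def] PM ..
  have ot: "OT N \<epsilon> c \<rho> = OT N \<epsilon> c M"
    unfolding OT_def co sc ..
  have wd: "\<forall>u\<in>dual_dom N \<epsilon> M.
       (\<forall>i\<in>{1..N}. (\<integral>\<^sup>+x. e2ennreal (u i x) \<partial>\<rho> i) < \<infinity>) \<and>
       gibbs N \<epsilon> c u \<in> borel_measurable (PiM {1..N} M) \<and>
       (\<integral>\<^sup>+x. gibbs N \<epsilon> c u x \<partial>(PiM {1..N} M)) < \<infinity> \<and>
       dual N \<epsilon> c M u < \<infinity>"
  proof (intro ballI conjI)
    fix u i assume u: "u \<in> dual_dom N \<epsilon> M"
    show "gibbs N \<epsilon> c u \<in> borel_measurable (PiM {1..N} M)"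
      by (intro gibbs_measurable dual_dom_measurable[OF u])
    show "(\<integral>\<^sup>+x. gibbs N \<epsilon> c u x \<partial>(PiM {1..N} M)) < \<infinity>" by (rule nn_integral_gibbs_finite[OF u])
    show "dual N \<epsilon> c M u < \<infinity>" by (rule dual_less_top[OF u])
    assume i: "i \<in> {1..N}"
    have "u i \<in> Lexp \<epsilon> (M i)" using u i unfolding dual_dom_def by blast
    then have "u i \<in> Lexp \<epsilon> (\<rho> i)" unfolding M[OF i] .
    then show "(\<integral>\<^sup>+x. e2ennreal (u i x) \<partial>\<rho> i) < \<infinity>" by (rule nn_integral_pos_part_Lexp[OF assms(6)])
  qed
  show ?thesis
    unfolding PM one dd du ct co sc ot
  proof (intro conjI, goal_cases)
    case 1
    show ?case by (rule wd)
  next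
    case 2
    show ?case using c_transform1_improves by blast
  next
    case 3
    show ?case using entropic_duality(1) by (simp only: M[symmetric] cong: ball_cong)
  next
    case 4
    show ?case by (rule entropic_duality(2))
  qed
qed

end
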